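(* Fix $n=1,2,\ldots$ and let $\mathscr K^{(n)}$ denote the family of compact subsets of $\mathbb R^n$. For any Borel set $E\subseteq\mathbb R^n$ define $$\bar\lambda_n(E)=\sup_{E\supseteq K\in\mathscr K^{(n)}}\ \inf_{K\subseteq P\in\mathscr P^{(n)}}\lambda_n(P).$$ Then $\bar\lambda_n(E)=\mathcal L^n(E)$, where $\mathcal L^n$ denotes Lebesgue measure on $\mathbb R^n$.
   Context: A rational polyhedron in $\mathbb R^n$ is a union of finitely many (closed) simplexes in $\mathbb R^n$ whose vertices are in $\mathbb Q^n$ (the empty set is included). $\mathscr P^{(n)}$ is the set of all rational polyhedra in $\mathbb R^n$. For a rational point $x=(x_1,\ldots,x_n)\in\mathbb Q^n$, $\operatorname{den}(x)$ is the least common denominator (a positive integer) of its coordinates, and $\tilde x=\operatorname{den}(x)(x_1,\ldots,x_n,1)\in\mathbb Z^{n+1}$ is its homogeneous correspondent. A simplex is rational if all its vertices are rational. A rational $m$-simplex $\operatorname{conv}(v_0,\ldots,v_m)\subseteq\mathbb R^n$ is regular if $\{\tilde v_0,\ldots,\tilde v_m\}$ is part of a basis of the free abelian group $\mathbb Z^{n+1}$. A simplicial complex is a finite set of simplexes in $\mathbb R^n$, closed under taking faces, any two of which intersect in a common face. A regular triangulation of $P$ is a simplicial complex $\Delta$ all of whose simplexes are rational and regular, and whose union is $P$. $\Delta^{\max}(n)$ denotes the set of (maximal) $n$-dimensional simplexes of $\Delta$. For a regular simplex $T=\operatorname{conv}(v_0,\ldots,v_m)$ put $\operatorname{den}(T)=\prod_{j=0}^m\operatorname{den}(v_j)$.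 For $P\in\mathscr P^{(n)}$ the $n$-dimensional rational measure is $$\lambda_n(P)=\sum_{T\in\Delta^{\max}(n)}\frac{1}{n!\,\operatorname{den}(T)},$$ where $\Delta$ is an arbitrary regular triangulation of $P$ (one exists and the value does not depend on the choice of $\Delta$), the sum being $0$ if $\Delta^{\max}(n)=\emptyset$. *)

theory Defs
  imports "HOL-Analysis.Analysis"
begin

definition rational_point :: "real ^ 'n \<Rightarrow> bool" where
  "rational_point x \<longleftrightarrow> (\<forall>i. x $ i \<in> \<rat>)"

text \<open>The value is only meaningful at rational points.\<close>
definition den :: "real ^ 'n \<Rightarrow> nat" where
  "den x = (LEAST d. d > 0 \<and> (\<forall>i. real d * x $ i \<in> \<int>))"

text \<open>The lattice of rank \<open>n + 1\<close> is \<open>int ^ 'n option\<close>, the last coordinate being indexed by \<open>None\<close>.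
  At rational points the numbers \<open>real (den x) * x $ i\<close> are integers, so no rounding takes place.\<close>
definition homogeneous :: "real ^ 'n \<Rightarrow> int ^ 'n option" where
  "homogeneous x =
    (\<chi> j. case j of Some i \<Rightarrow> \<lfloor>real (den x) * x $ i\<rfloor> | None \<Rightarrow> int (den x))"

definition lattice_basis :: "(int ^ 'm) set \<Rightarrow> bool" where
  "lattice_basis B \<longleftrightarrow>
    \<not> module.dependent ((*s) :: int \<Rightarrow> _) B \<and> module.span ((*s) :: int \<Rightarrow> _) B = UNIV"

lemma module_int_vec: "module ((*s) :: int \<Rightarrow> int ^ 'm \<Rightarrow> int ^ 'm)"
  by unfold_locales (simp_all add: vec_eq_iff algebra_simps)

definition vertices :: "(real ^ 'n) set \<Rightarrow> (real ^ 'n) set" where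
  "vertices T = {v. v extreme_point_of T}"

text \<open>The empty set counts as the \<open>-1\<close>-dimensional simplex, as it does in \<^const>\<open>simplicial_complex\<close>
  (where it is a face of every simplex); it is trivially rational and regular.\<close>
definition rational_simplex :: "(real ^ 'n) set \<Rightarrow> bool" where
  "rational_simplex T \<longleftrightarrow> (\<exists>m. m simplex T) \<and> (\<forall>v\<in>vertices T. rational_point v)"

definition regular_simplex :: "(real ^ 'n) set \<Rightarrow> bool" where
  "regular_simplex T \<longleftrightarrow>
    rational_simplex T \<and> (\<exists>B. lattice_basis B \<and> homogeneous ` vertices T \<subseteq> B)"

definition rational_polyhedron :: "(real ^ 'n) set \<Rightarrow> bool" where
  "rational_polyhedron P \<longleftrightarrow> (\<exists>F. finite F \<and> (\<forall>T\<in>F. rational_simplex T) \<and> P = \<Union>F)"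

definition regular_triangulation :: "(real ^ 'n) set set \<Rightarrow> (real ^ 'n) set \<Rightarrow> bool" where
  "regular_triangulation \<Delta> P \<longleftrightarrow>
    simplicial_complex \<Delta> \<and> (\<forall>T\<in>\<Delta>. regular_simplex T) \<and> \<Union>\<Delta> = P"

definition simplex_den :: "(real ^ 'n) set \<Rightarrow> nat" where
  "simplex_den T = (\<Prod>v\<in>vertices T. den v)"

definition triangulation_measure :: "(real ^ 'n) set set \<Rightarrow> real" where
  "triangulation_measure \<Delta> =
    (\<Sum>T\<in>{T \<in> \<Delta>. int CARD('n) simplex T}. 1 / (fact CARD('n) * real (simplex_den T)))"

text \<open>Every rational polyhedron has a regular triangulation, and the sum does not depend on it, so the
  choice made here is immaterial; on other sets the value is meaningless.\<close>
definition rational_measure :: "(real ^ 'n) set \<Rightarrow> real" where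
  "rational_measure P = triangulation_measure (SOME \<Delta>. regular_triangulation \<Delta> P)"

definition rational_measure_ext :: "(real ^ 'n) set \<Rightarrow> ennreal" where
  "rational_measure_ext E =
    (SUP K \<in> {K. compact K \<and> K \<subseteq> E}.
      INF P \<in> {P. rational_polyhedron P \<and> K \<subseteq> P}. ennreal (rational_measure P))"

end

theory Submission
  imports Defs
begin

text \<open>
  The main point is that the rational measure of a rational polyhedron \<open>P\<close> is its Lebesgue measure; the
  rest is regularity of Lebesgue measure, since a compact set inside an open set can be covered by
  finitely many small rational simplexes.

  A regular triangulation of \<open>P\<close> exists for the following reason. Work with cones in the lattice of rank
  \<open>n + 1\<close>. The cone over \<open>P\<close> lies in a single unimodular cone, some of whose rays are points at
  infinity. Subdividing an edge \<open>{a, b}\<close> at the Farey mediant \<open>a + b\<close> preserves unimodularity, and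
  finitely many such subdivisions make every cone lie on one side of each hyperplane in a given finite
  rational family. For the hyperplanes bounding the cones over the simplexes of \<open>P\<close>, the cone over \<open>P\<close>
  becomes a union of cones of the subdivision, and cutting those at height 1 gives the triangulation.

  The vertices of a regular \<open>n\<close>-simplex \<open>T\<close> have homogeneous correspondents of determinant \<open>1\<close> or \<open>-1\<close>.
  Dividing each by its denominator gives \<open>n! vol T = 1 / den T\<close>.
\<close>

section \<open>Unimodular fans and Farey subdivision\<close>

text \<open>Triangulations of the separate simplexes of \<open>P\<close> need not fit together.
  Hence one fan is subdivided, and \<open>P\<close> enters only through linear forms that must not
  change sign on any cone. Starting from the cone over a translated orthant makes the first fan
  unimodular at no cost. The price is rays of height 0. They drop out because a cone whose relative
  interior meets the cone over a bounded simplex \<open>T\<close> ends up with all its generators in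
  the cone over \<open>T\<close>, hence at positive height.

  Subdividing edges is enough: a form takes both signs on a cone exactly when it does so on two of
  its generators, and these span an edge of the fan.

  Cones are handled through coefficient functions on the lattice. A subdivision becomes an explicit
  change of coefficients, and intersections of cones are controlled by uniqueness of coefficients
  alone.

  Every regular triangulation is compared with Lebesgue measure, so the independence of the sum from
  the triangulation needs no argument of its own.\<close>

interpretation int_vec: module "(*s) :: int \<Rightarrow> int ^ 'm \<Rightarrow> int ^ 'm"
  by (rule module_int_vec)

definition real_vec :: "int ^ 'm \<Rightarrow> real ^ 'm" where
  "real_vec v = (\<chi> i. real_of_int (v $ i))"

lemma real_vec_nth [simp]: "real_vec v $ i = real_of_int (v $ i)"
  by (simp add: real_vec_def)

lemma real_vec_add: "real_vec (v + w) = real_vec v + real_vec w"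
  by (simp add: vec_eq_iff)

text \<open>Coefficients are functions on the whole lattice, so that combinations over different
  cones can be compared by equality of functions. The sum over an infinite support is 0 by
  convention, which explains the finiteness hypotheses below.\<close>

definition lin :: "(int ^ 'm \<Rightarrow> real) \<Rightarrow> real ^ 'm" where
  "lin c = (\<Sum>v | c v \<noteq> 0. c v *\<^sub>R real_vec v)"

lemma lin_eq_sum: "finite A \<Longrightarrow> {v. c v \<noteq> 0} \<subseteq> A \<Longrightarrow> lin c = (\<Sum>v\<in>A. c v *\<^sub>R real_vec v)"
  unfolding lin_def by (rule sum.mono_neutral_left) auto

lemma lin_add_scale:
  assumes "finite {v. c v \<noteq> 0}" "finite {v. d v \<noteq> 0}"
  shows "lin (\<lambda>v. c v + t * d v) = lin c + t *\<^sub>R lin d"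
proof -
  define A where "A = {v. c v \<noteq> 0} \<union> {v. d v \<noteq> 0}"
  have "finite A" using assms by (simp add: A_def)
  then have "lin c = (\<Sum>v\<in>A. c v *\<^sub>R real_vec v)" "lin d = (\<Sum>v\<in>A. d v *\<^sub>R real_vec v)"
    "lin (\<lambda>v. c v + t * d v) = (\<Sum>v\<in>A. (c v + t * d v) *\<^sub>R real_vec v)"
    by (auto intro!: lin_eq_sum simp: A_def)
  then show ?thesis
    by (simp add: sum.distrib scaleR_add_left scaleR_sum_right)
qed

lemma inner_lin: "x \<bullet> lin c = (\<Sum>v | c v \<noteq> 0. c v * (x \<bullet> real_vec v))"
  by (simp add: lin_def inner_sum_right)

text \<open>The support itself has to be a member. For a family closed under subsets this amounts to
  lying in some member, and the support then names the smallest cone containing the point.\<close>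

definition conic_rep :: "(int ^ 'm) set set \<Rightarrow> (int ^ 'm \<Rightarrow> real) \<Rightarrow> bool" where
  "conic_rep K c \<longleftrightarrow> (\<forall>v. 0 \<le> c v) \<and> {v. c v \<noteq> 0} \<in> K"

definition fan_support :: "(int ^ 'm) set set \<Rightarrow> (real ^ 'm) set" where
  "fan_support K = lin ` Collect (conic_rep K)"

definition unimodular :: "(int ^ 'm) set \<Rightarrow> bool" where
  "unimodular S \<longleftrightarrow> finite S \<and> (\<exists>B. lattice_basis B \<and> S \<subseteq> B)"

text \<open>A fan is given by the ray generators of its cones. Injectivity of \<^const>\<open>lin\<close> says at once that the
  cones are simplicial and that any two of them meet in the cone over their common generators.\<close>

definition fan :: "(int ^ 'm) set set \<Rightarrow> bool" where
  "fan K \<longleftrightarrow> finite K \<and> (\<forall>S\<in>K. unimodular S) \<and> (\<forall>S\<in>K. \<forall>S'\<subseteq>S. S' \<in> K)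
     \<and> inj_on lin (Collect (conic_rep K))"

text \<open>Stellar subdivision of the edge \<open>{a, b}\<close> at \<open>a + b\<close>: the
  second part joins the new ray to those faces of the closed star of the edge that do not contain
  the edge.\<close>

definition farey :: "(int ^ 'm) set set \<Rightarrow> int ^ 'm \<Rightarrow> int ^ 'm \<Rightarrow> (int ^ 'm) set set" where
  "farey K a b = {S \<in> K. \<not> {a, b} \<subseteq> S} \<union>
     insert (a + b) ` {S. \<not> {a, b} \<subseteq> S \<and> insert a (insert b S) \<in> K}"

text \<open>Moves a conic combination along the linear relation between the rays \<open>a\<close>, \<open>b\<close> and \<open>a + b\<close>.\<close>

definition farey_shift ::
    "int ^ 'm \<Rightarrow> int ^ 'm \<Rightarrow> real \<Rightarrow> (int ^ 'm \<Rightarrow> real) \<Rightarrow> int ^ 'm \<Rightarrow> real" where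
  "farey_shift a b t c v = c v + t * (of_bool (v = a) + of_bool (v = b) - of_bool (v = a + b))"

lemma farey_cases:
  assumes "S \<in> farey K a b"
  obtains "S \<in> K" "\<not> {a, b} \<subseteq> S"
  | S' where "S = insert (a + b) S'" "\<not> {a, b} \<subseteq> S'" "insert a (insert b S') \<in> K"
  using assms unfolding farey_def by blast

text \<open>Adding one basis vector to another is invertible over the integers. The old
  \<open>a\<close> is \<open>(a + b) - b\<close>, and a relation among the new vectors becomes one
  among the old, in which \<open>a\<close> has the coefficient of \<open>a + b\<close>, and
  \<open>b\<close> has the sum of the coefficients of \<open>a + b\<close> and
  \<open>b\<close>.\<close>

lemma lattice_basis_exchange:
  fixes B :: "(int ^ 'm) set"
  assumes B: "lattice_basis B" and ab: "a \<in> B" "b \<in> B" "a \<noteq> b"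
  shows "lattice_basis (insert (a + b) (B - {a}))"
proof -
  let ?C = "insert (a + b) (B - {a})"
  have ind: "int_vec.independent B" and sp: "int_vec.span B = UNIV"
    using B by (auto simp: lattice_basis_def)
  have "b \<in> int_vec.span ?C" "a + b \<in> int_vec.span ?C"
    using ab by (auto intro: int_vec.span_base)
  then have "a \<in> int_vec.span ?C"
    using int_vec.span_diff[of "a + b" ?C b] by simp
  then have "B \<subseteq> int_vec.span ?C"
    using int_vec.span_base[of _ ?C] by auto
  then have spC: "int_vec.span ?C = UNIV"
    using int_vec.span_minimal[OF _ int_vec.subspace_span, of B ?C] sp by auto
  have notin: "a + b \<notin> B - {a}"
  proof
    assume "a + b \<in> B - {a}"
    then have c: "a + b \<in> B" "a + b \<noteq> a" by auto
    have "a + b \<noteq> b"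
      using ab ind int_vec.dependent_zero by force
    have "int_vec.dependent B"
      unfolding int_vec.dependent_explicit
      by (rule exI[of _ "{a, b, a + b}"], rule exI[of _ "\<lambda>v. if v = a + b then -1 else 1"])
        (use ab c \<open>a + b \<noteq> b\<close> in \<open>auto simp: vec_eq_iff\<close>)
    then show False using ind by blast
  qed
  have "int_vec.independent ?C"
  proof
    assume "int_vec.dependent ?C"
    then obtain t u where t: "finite t" "t \<subseteq> ?C" "(\<Sum>v\<in>t. u v *s v) = 0" "\<exists>v\<in>t. u v \<noteq> 0"
      unfolding int_vec.dependent_explicit by blast
    \<comment> \<open>Extending the coefficients by 0 allows \<open>a + b\<close> and
      \<open>b\<close> to be split off whether or not they occur in \<open>t\<close>.\<close>
    define w where "w v = (if v \<in> t then u v else 0)" for v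
    define s where "s = t - {a + b} - {b}"
    have fin: "finite s" "s \<subseteq> B" "a \<notin> s" "b \<notin> s" using t by (auto simp: s_def)
    have supp: "v \<in> s \<or> v = a + b \<or> v = b" if "w v \<noteq> 0" for v
      using that t by (auto simp: w_def s_def split: if_splits)
    have ne: "a + b \<noteq> b"
      using ab ind int_vec.dependent_zero by force
    have ns: "a + b \<notin> s" by (auto simp: s_def)
    have "(\<Sum>v\<in>t. u v *s v) = (\<Sum>v\<in>insert (a + b) (insert b s). w v *s v)"
    proof -
      have "(\<Sum>v\<in>t. u v *s v) = (\<Sum>v\<in>t. w v *s v)" by (simp add: w_def)
      also have "\<dots> = (\<Sum>v\<in>insert (a + b) (insert b s). w v *s v)"
        by (rule sum.mono_neutral_left) (use t in \<open>auto simp: s_def w_def\<close>)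
      finally show ?thesis .
    qed
    also have "\<dots> = w (a + b) *s (a + b) + (w b *s b + (\<Sum>v\<in>s. w v *s v))"
      using fin ne ns by simp
    also have "\<dots> = w (a + b) *s a + ((w (a + b) + w b) *s b + (\<Sum>v\<in>s. w v *s v))"
      by (simp add: vec_eq_iff algebra_simps)
    also have "\<dots> = (\<Sum>v\<in>insert a (insert b s).
        (if v = a then w (a + b) else if v = b then w (a + b) + w b else w v) *s v)"
    proof -
      have "(\<Sum>v\<in>s. w v *s v) = (\<Sum>v\<in>s.
          (if v = a then w (a + b) else if v = b then w (a + b) + w b else w v) *s v)"
        by (rule sum.cong) (use fin in auto)
      then show ?thesis using fin ab by simp
    qed
    finally have z: "(\<Sum>v\<in>insert a (insert b s).
        (if v = a then w (a + b) else if v = b then w (a + b) + w b else w v) *s v) = 0"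
      using t by simp
    have D: "(if v = a then w (a + b) else if v = b then w (a + b) + w b else w v) = 0"
      if "v \<in> insert a (insert b s)" for v
      using int_vec.independentD[OF ind _ _ z that] fin ab by auto
    have "w (a + b) = 0" using D[of a] by simp
    moreover have "w b = 0" using D[of b] ab calculation by simp
    moreover have "w v = 0" if "v \<in> s" for v
    proof -
      have "v \<noteq> a" "v \<noteq> b" using that fin by auto
      then show ?thesis using D[of v] that by simp
    qed
    ultimately have w0: "w v = 0" for v using supp[of v] by metis
    from t(4) obtain v where "v \<in> t" "u v \<noteq> 0" by blast
    then show False using w0[of v] by (simp add: w_def)
  qed
  with spC show ?thesis by (simp add: lattice_basis_def)
qed

text \<open>\<open>S\<close> misses \<open>a\<close> or \<open>b\<close>; the missing one is
  exchanged for \<open>a + b\<close>.\<close>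

lemma unimodular_exchange:
  assumes "unimodular (insert a (insert b S))" "a \<noteq> b" "\<not> {a, b} \<subseteq> S"
  shows "unimodular (insert (a + b) S)"
proof -
  obtain B where B: "lattice_basis B" "insert a (insert b S) \<subseteq> B" and f: "finite S"
    using assms by (auto simp: unimodular_def)
  from assms(3) consider "a \<notin> S" | "b \<notin> S" by auto
  then show ?thesis
  proof cases
    case 1
    then show ?thesis
      using lattice_basis_exchange[of B a b] B assms(2) f unfolding unimodular_def by blast
  next
    case 2
    have "lattice_basis (insert (b + a) (B - {b}))"
      using lattice_basis_exchange[of B b a] B assms(2) by blast
    moreover have "insert (a + b) S \<subseteq> insert (b + a) (B - {b})"
      using 2 B by (auto simp: add.commute)
    ultimately show ?thesis
      using f unfolding unimodular_def by blast
  qed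
qed

lemma lin_indicator: "lin (\<lambda>v. of_bool (v = a)) = real_vec a"
  by (subst lin_eq_sum[of "{a}"]) auto

lemma lin_edge:
  fixes a b :: "int ^ 'm"
  assumes "a \<noteq> b"
  shows "lin (\<lambda>v. of_bool (v = a) + of_bool (v = b)) = real_vec (a + b)"
  using assms by (subst lin_eq_sum[of "{a, b}"]) (auto simp: real_vec_add)

lemma lin_farey_relation:
  fixes a b :: "int ^ 'm"
  assumes "a \<noteq> b" "a + b \<noteq> a" "a + b \<noteq> b"
  shows "lin (\<lambda>v. of_bool (v = a) + of_bool (v = b) - of_bool (v = a + b)) = 0"
  using assms by (subst lin_eq_sum[of "{a, b, a + b}"]) (auto simp: real_vec_add)

lemma fan_finite: "fan K \<Longrightarrow> S \<in> K \<Longrightarrow> finite S"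
  by (auto simp: fan_def unimodular_def)

lemma fan_subset: "fan K \<Longrightarrow> S \<in> K \<Longrightarrow> T \<subseteq> S \<Longrightarrow> T \<in> K"
  unfolding fan_def by blast

context
  fixes K :: "(int ^ 'm) set set" and a b :: "int ^ 'm"
  assumes fan: "fan K" and edge: "{a, b} \<in> K" "a \<noteq> b"
begin

text \<open>Otherwise the vector \<open>a + b\<close> would have two conic representations, one on
  its own ray and one on the edge \<open>{a, b}\<close>, against injectivity of
  \<open>lin\<close>.\<close>

lemma farey_new_vertex:
  assumes "S \<in> K" shows "a + b \<notin> S"
proof
  assume "a + b \<in> S"
  then have "{a + b} \<in> K" using fan_subset[OF fan assms] by auto
  then have "conic_rep K (\<lambda>v. of_bool (v = a + b))"
    by (auto simp: conic_rep_def)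
  moreover have "{v. v = a \<or> v = b} = {a, b}" by auto
  then have "conic_rep K (\<lambda>v. of_bool (v = a) + of_bool (v = b))"
    using edge by (auto simp: conic_rep_def add_nonneg_eq_0_iff)
  moreover have "lin (\<lambda>v. of_bool (v = a) + of_bool (v = b)) = lin (\<lambda>v. of_bool (v = a + b))"
    using edge by (simp add: lin_edge lin_indicator)
  moreover have "inj_on lin (Collect (conic_rep K))" using fan by (simp add: fan_def)
  ultimately have *: "(\<lambda>v. of_bool (v = a) + of_bool (v = b)) = (\<lambda>v. of_bool (v = a + b) :: real)"
    unfolding inj_on_def by blast
  show False
    using fun_cong[OF *, of a] fun_cong[OF *, of b] edge by (auto split: if_splits)
qed

lemma farey_distinct: "a + b \<noteq> a" "a + b \<noteq> b"
  using farey_new_vertex[OF edge(1)] by auto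

lemma lin_shift: 
  assumes "finite {v. c v \<noteq> 0}"
  shows "lin (farey_shift a b t c) = lin c"
proof -
  have "{v. of_bool (v = a) + of_bool (v = b) - of_bool (v = a + b) \<noteq> (0::real)} \<subseteq> {a, b, a + b}"
    by auto
  then have "finite {v. of_bool (v = a) + of_bool (v = b) - of_bool (v = a + b) \<noteq> (0::real)}"
    using finite_subset by blast
  from lin_add_scale[OF assms this, of t]
  show ?thesis using lin_farey_relation[OF edge(2) farey_distinct]
    by (simp add: farey_shift_def[abs_def])
qed

text \<open>The weight of the new ray is handed back to \<open>a\<close> and \<open>b\<close>, which
  leads into an old cone containing the edge. The equation for \<open>min\<close> holds because no
  new cone contains both \<open>a\<close> and \<open>b\<close>; it lets \<open>shift_inverse\<close>
  recover the weight that was moved.\<close>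

lemma conic_rep_down:
  assumes "conic_rep (farey K a b) c"
  shows "conic_rep K (farey_shift a b (c (a + b)) c)" "min (c a) (c b) = 0" "finite {v. c v \<noteq> 0}"
proof -
  have pos: "0 \<le> c v" for v using assms by (simp add: conic_rep_def)
  have S: "{v. c v \<noteq> 0} \<in> farey K a b" using assms by (simp add: conic_rep_def)
  have pos': "0 \<le> farey_shift a b (c (a + b)) c v" for v
    using pos[of v] pos[of "a + b"] farey_distinct edge(2) by (auto simp: farey_shift_def of_bool_def)
  have "{v. farey_shift a b (c (a + b)) c v \<noteq> 0} \<in> K \<and> min (c a) (c b) = 0 \<and> finite {v. c v \<noteq> 0}"
    using S
  proof (cases rule: farey_cases)
    case 1
    then have "c (a + b) = 0" using farey_new_vertex by auto
    then show ?thesis using 1 fan_finite[OF fan] pos[of a] pos[of b]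
      by (auto simp: min_def farey_shift_def)
  next
    case (2 S')
    then have ns: "a + b \<notin> S'" using farey_new_vertex[of "insert a (insert b S')"] by auto
    have "{v. farey_shift a b (c (a + b)) c v \<noteq> 0} \<subseteq> insert a (insert b S')"
    proof
      fix v assume v: "v \<in> {v. farey_shift a b (c (a + b)) c v \<noteq> 0}"
      show "v \<in> insert a (insert b S')"
      proof (rule ccontr)
        assume n: "v \<notin> insert a (insert b S')"
        then have "v = a + b \<or> c v = 0" using 2 by auto
        then show False using v n farey_distinct by (auto simp: farey_shift_def split: if_splits)
      qed
    qed
    moreover have "a \<notin> {v. c v \<noteq> 0} \<or> b \<notin> {v. c v \<noteq> 0}" 
      using 2 farey_distinct by auto
    moreover have "finite {v. c v \<noteq> 0}" unfolding 2 using fan_finite[OF fan 2(3)] by simp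
    ultimately show ?thesis
      using fan_subset[OF fan 2(3)] pos[of a] pos[of b] by (auto simp: min_def)
  qed
  then show "conic_rep K (farey_shift a b (c (a + b)) c)" "min (c a) (c b) = 0" "finite {v. c v \<noteq> 0}"
    using pos' by (auto simp: conic_rep_def)
qed

text \<open>Moving the smaller of the two coefficients to \<open>a + b\<close> removes
  \<open>a\<close> or \<open>b\<close> from the support, so the new support no longer contains the
  edge.\<close>

lemma conic_rep_up:
  assumes "conic_rep K c"
  shows "conic_rep (farey K a b) (farey_shift a b (- min (c a) (c b)) c)" "finite {v. c v \<noteq> 0}"
proof -
  define t where "t = min (c a) (c b)"
  have pos: "0 \<le> c v" for v using assms by (simp add: conic_rep_def)
  have S: "{v. c v \<noteq> 0} \<in> K" using assms by (simp add: conic_rep_def)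
  then show fin: "finite {v. c v \<noteq> 0}" using fan_finite[OF fan] by simp
  have t: "0 \<le> t" "t \<le> c a" "t \<le> c b" "t = c a \<or> t = c b" using pos by (auto simp: t_def)
  have pos': "0 \<le> farey_shift a b (- t) c v" for v
    using pos[of v] t farey_distinct edge(2) by (auto simp: farey_shift_def of_bool_def)
  have cm: "c (a + b) = 0" using farey_new_vertex[OF S] by simp
  have "{v. farey_shift a b (- t) c v \<noteq> 0} \<in> farey K a b"
  proof (cases "t = 0")
    case True
    then show ?thesis using S t(4) by (auto simp: farey_def farey_shift_def)
  next
    case False
    \<comment> \<open>When both coefficients equal \<open>t\<close>, both \<open>a\<close> and
      \<open>b\<close> disappear.\<close>
    define S' where "S' = {v. c v \<noteq> 0} - {v. (v = a \<or> v = b) \<and> c v = t}"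
    have ab: "c a \<noteq> 0" "c b \<noteq> 0" using False t by auto
    then have "insert a (insert b S') = {v. c v \<noteq> 0}" by (auto simp: S'_def)
    moreover have "\<not> {a, b} \<subseteq> S'" using t by (auto simp: S'_def)
    moreover have "{v. farey_shift a b (- t) c v \<noteq> 0} = insert (a + b) S'"
    proof (rule set_eqI)
      fix v
      consider "v = a" | "v = b" | "v = a + b" | "v \<notin> {a, b, a + b}" by auto
      then show "v \<in> {v. farey_shift a b (- t) c v \<noteq> 0} \<longleftrightarrow> v \<in> insert (a + b) S'"
        by cases (use False cm ab farey_distinct edge(2) in
          \<open>simp_all add: S'_def farey_shift_def of_bool_def\<close>)
    qed
    ultimately show ?thesis using S by (auto simp: farey_def)
  qed
  then show "conic_rep (farey K a b) (farey_shift a b (- min (c a) (c b)) c)"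
    using pos' by (simp add: conic_rep_def t_def)
qed

text \<open>After the shift down, \<open>a\<close> and \<open>b\<close> carry their old coefficients
  plus that of \<open>a + b\<close>. One of the old coefficients is 0, so the smaller new one is
  exactly the coefficient of \<open>a + b\<close>.\<close>

lemma shift_inverse:
  assumes "conic_rep (farey K a b) c" "d = farey_shift a b (c (a + b)) c"
  shows "farey_shift a b (- min (d a) (d b)) d = c"
proof -
  have "min (d a) (d b) = c (a + b)"
    using conic_rep_down(2)[OF assms(1)] assms(2) farey_distinct edge(2)
    by (simp add: farey_shift_def of_bool_def min_def split: if_splits)
  then have "farey_shift a b (- min (d a) (d b)) d v = c v" for v
    unfolding farey_shift_def[of _ _ _ d] by (simp add: assms(2) farey_shift_def)
  then show ?thesis by blast
qed

text \<open>Injectivity of \<open>lin\<close> is inherited from \<open>K\<close>: shifting down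
  changes no vector, gives representations in \<open>K\<close>, and can be undone by
  \<open>shift_inverse\<close>.\<close>

lemma fan_farey: "fan (farey K a b)"
  unfolding fan_def
proof (intro conjI ballI allI impI)
  have "{S. \<not> {a, b} \<subseteq> S \<and> insert a (insert b S) \<in> K} \<subseteq> K"
    using fan_subset[OF fan] by auto
  then show "finite (farey K a b)"
    using fan unfolding farey_def fan_def by (auto dest: finite_subset)
next
  fix S assume "S \<in> farey K a b"
  then show "unimodular S"
    by (cases rule: farey_cases) (use fan edge in \<open>auto simp: fan_def intro!: unimodular_exchange\<close>)
next
  fix S S' assume S: "S \<in> farey K a b" and sub: "S' \<subseteq> S"
  from S show "S' \<in> farey K a b"
  proof (cases rule: farey_cases)
    case 1
    then show ?thesis using sub fan_subset[OF fan 1(1)] by (auto simp: farey_def)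
  next
    case (2 R)
    show ?thesis
    proof (cases "a + b \<in> S'")
      case True
      then have "S' = insert (a + b) (S' - {a + b})" by auto
      moreover have "insert a (insert b (S' - {a + b})) \<in> K"
        using 2 sub by (intro fan_subset[OF fan 2(3)]) auto
      moreover have "\<not> {a, b} \<subseteq> S' - {a + b}" using 2 sub by auto
      ultimately show ?thesis unfolding farey_def by blast
    next
      case False
      then have "S' \<subseteq> R" using 2 sub by auto
      then have "S' \<in> K" "\<not> {a, b} \<subseteq> S'" using 2 fan_subset[OF fan 2(3), of S'] by auto
      then show ?thesis by (simp add: farey_def)
    qed
  qed
next
  show "inj_on lin (Collect (conic_rep (farey K a b)))"
  proof (rule inj_onI)
    fix c d assume cd: "c \<in> Collect (conic_rep (farey K a b))" "d \<in> Collect (conic_rep (farey K a b))"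
      and eq: "lin c = lin d"
    then have c: "conic_rep (farey K a b) c" and d: "conic_rep (farey K a b) d" by auto
    have inj: "inj_on lin (Collect (conic_rep K))" using fan by (simp add: fan_def)
    have "lin (farey_shift a b (c (a + b)) c) = lin (farey_shift a b (d (a + b)) d)"
      using eq lin_shift conic_rep_down(3)[OF c] conic_rep_down(3)[OF d] by simp
    then have "farey_shift a b (c (a + b)) c = farey_shift a b (d (a + b)) d"
      by (rule inj_onD[OF inj]) (simp_all add: conic_rep_down(1)[OF c] conic_rep_down(1)[OF d])
    from shift_inverse[OF c refl] shift_inverse[OF d this] show "c = d" by (rule trans[OF sym])
  qed
qed

lemma fan_support_farey: "fan_support K \<subseteq> fan_support (farey K a b)"
proof
  fix x assume "x \<in> fan_support K"
  then obtain c where c: "conic_rep K c" "x = lin c" by (auto simp: fan_support_def)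
  then have "x = lin (farey_shift a b (- min (c a) (c b)) c)" using lin_shift conic_rep_up(2) by simp
  then show "x \<in> fan_support (farey K a b)"
    using conic_rep_up(1)[OF c(1)] by (auto simp: fan_support_def)
qed

end

section \<open>Removing sign changes of linear forms by repeated subdivision\<close>

text \<open>For additive \<open>l\<close> these are the edges crossed by the hyperplane where
  \<open>l\<close> vanishes. In a fan, which is closed under faces, their absence means that no cone
  has generators strictly on both sides.\<close>

definition sign_conflicts :: "(int ^ 'm \<Rightarrow> int) \<Rightarrow> (int ^ 'm) set set \<Rightarrow> ((int ^ 'm) \<times> (int ^ 'm)) set" where
  "sign_conflicts l K = {(a, b). {a, b} \<in> K \<and> l a > 0 \<and> l b < 0}"

lemma finite_sign_conflicts: 
  assumes "fan K" shows "finite (sign_conflicts l K)"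
proof -
  have "finite (\<Union>K)" using assms by (auto simp: fan_def unimodular_def)
  moreover have "sign_conflicts l K \<subseteq> \<Union>K \<times> \<Union>K" by (auto simp: sign_conflicts_def)
  ultimately show ?thesis using finite_subset by blast
qed

text \<open>A new edge ends at \<open>a + b\<close>, and its other end lies in the closed star of
  \<open>{a, b}\<close>, hence is joined to both \<open>a\<close> and \<open>b\<close>. Thus a
  conflict at the new ray can be compared with old edges.\<close>

lemma sign_conflicts_farey:
  assumes "fan K" "(x, y) \<in> sign_conflicts l (farey K a b)"
  obtains "(x, y) \<in> sign_conflicts l K" "\<not> {a, b} \<subseteq> {x, y}"
  | "x = a + b" "{a, y} \<in> K" "{b, y} \<in> K"
  | "y = a + b" "{x, a} \<in> K" "{x, b} \<in> K"
proof -
  have xy: "{x, y} \<in> farey K a b" "l x > 0" "l y < 0"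
    using assms by (auto simp: sign_conflicts_def)
  then have ne: "x \<noteq> y" by auto
  from xy(1) show thesis
  proof (cases rule: farey_cases)
    case 1
    then show thesis using that(1) xy by (auto simp: sign_conflicts_def)
  next
    case (2 S)
    have "a + b \<in> {x, y}" by (simp only: 2(1)) simp
    moreover have "x \<in> insert (a + b) S" "y \<in> insert (a + b) S"
      unfolding 2(1)[symmetric] by simp_all
    ultimately consider "x = a + b" "y \<in> S" | "y = a + b" "x \<in> S" using ne by auto
    then show thesis
    proof cases
      case 1
      then have "{a, y} \<in> K" "{b, y} \<in> K" using fan_subset[OF assms(1) 2(3)] by auto
      with 1 show thesis using that(2) by blast
    next
      case c: 2
      then have "{x, a} \<in> K" "{x, b} \<in> K" using fan_subset[OF assms(1) 2(3)] by auto
      with c show thesis using that(3) by blast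
    qed
  qed
qed

text \<open>Subdividing for one form must not spoil another. If \<open>l (a + b)\<close> is
  positive, so is \<open>l a\<close> or \<open>l b\<close>, and likewise for negative values, so a
  conflict at \<open>a + b\<close> would come from an old one.\<close>

lemma sign_conflicts_farey_empty:
  assumes "fan K" and l: "\<And>v w. l (v + w) = l v + l w" and e: "sign_conflicts l K = {}"
  shows "sign_conflicts l (farey K a b) = {}"
proof (rule equals0I, clarify)
  fix x y assume xy: "(x, y) \<in> sign_conflicts l (farey K a b)"
  then have s: "l x > 0" "l y < 0" by (auto simp: sign_conflicts_def)
  have n: False if "{v, w} \<in> K" "l v > 0" "l w < 0" for v w
    using that e by (auto simp: sign_conflicts_def)
  from assms(1) xy show False
  proof (cases rule: sign_conflicts_farey)
    case 1 then show False using e by auto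
  next
    case 2 
    then have "l a > 0 \<or> l b > 0" using s l[of a b] by auto
    then show False using n 2 s by blast
  next
    case 3 
    then have "l a < 0 \<or> l b < 0" using s l[of a b] by auto
    then show False using n 3 s by blast
  qed
qed

text \<open>Collects what has to survive repeated subdivision. The last conjunct allows the forms to
  be treated one after another.\<close>

definition refines :: "(int ^ 'm) set set \<Rightarrow> (int ^ 'm) set set \<Rightarrow> bool" where
  "refines K K' \<longleftrightarrow> fan K' \<and> fan_support K \<subseteq> fan_support K' \<and>
     (\<forall>l. (\<forall>v w. l (v + w) = l v + l w) \<longrightarrow> sign_conflicts l K = {} \<longrightarrow> sign_conflicts l K' = {})"

lemma refines_refl: "fan K \<Longrightarrow> refines K K"
  by (auto simp: refines_def)

lemma refines_trans: "refines K K' \<Longrightarrow> refines K' K'' \<Longrightarrow> refines K K''"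
  by (auto simp: refines_def)

lemma refines_farey: "fan K \<Longrightarrow> {a, b} \<in> K \<Longrightarrow> a \<noteq> b \<Longrightarrow> refines K (farey K a b)"
  unfolding refines_def
  by (intro conjI allI impI fan_farey fan_support_farey sign_conflicts_farey_empty) auto

text \<open>Termination of the subdivision process: subdividing a conflicting edge of maximal width
  \<open>l a - l b\<close> only creates conflicting edges of smaller width.\<close>

lemma refine_bounded:
  fixes l :: "int ^ 'm \<Rightarrow> int"
  assumes l: "\<And>v w. l (v + w) = l v + l w"
  assumes "fan K" "\<forall>(a, b)\<in>sign_conflicts l K. l a - l b \<le> int W"
  shows "\<exists>K'. refines K K' \<and> sign_conflicts l K' = {}"
  using assms(2,3)
proof (induction W arbitrary: K)
  case 0
  have "sign_conflicts l K = {}"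
    using 0(2) by (fastforce simp: sign_conflicts_def)
  then show ?case using 0(1) refines_refl by blast
next
  case (Suc W)
  \<comment> \<open>The induction is lexicographic: on the bound for the widths, then on the number
    of edges that attain it.\<close>
  define wide where "wide K = {(a, b) \<in> sign_conflicts l K. l a - l b = int (Suc W)}" for K
  from Suc.prems show ?case
  proof (induction "card (wide K)" arbitrary: K rule: less_induct)
    case less
    show ?case
    proof (cases "wide K = {}")
      case True
      have "\<forall>(a, b)\<in>sign_conflicts l K. l a - l b \<le> int W"
      proof clarify
        fix a b assume "(a, b) \<in> sign_conflicts l K"
        with True less.prems(2) have "l a - l b \<le> int (Suc W)" "l a - l b \<noteq> int (Suc W)"
          by (auto simp: wide_def)
        then show "l a - l b \<le> int W" by linarith
      qed
      then show ?thesis using Suc.IH less.prems(1) by blast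
    next
      case False
      then obtain a b where ab: "(a, b) \<in> wide K" by auto
      then have e: "{a, b} \<in> K" "l a > 0" "l b < 0" by (auto simp: wide_def sign_conflicts_def)
      then have ne: "a \<noteq> b" by auto
      let ?K = "farey K a b"
      have ref: "refines K ?K" using refines_farey less.prems(1) e ne by blast
      have le: "l v - l w \<le> int (Suc W)" if "{v, w} \<in> K" "l v > 0" "l w < 0" for v w
        using that less.prems(2) by (auto simp: sign_conflicts_def)
      \<comment> \<open>Since \<open>l b < 0 < l a\<close>, the value \<open>l (a + b)\<close> lies
        strictly between \<open>l b\<close> and \<open>l a\<close>. A conflicting edge at the new
        ray is therefore strictly narrower than a conflicting old edge with the same other
        end.\<close>
      have new: "(x, y) \<in> sign_conflicts l K - {(a, b)} \<or> l x - l y < int (Suc W)"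
        if xy: "(x, y) \<in> sign_conflicts l ?K" for x y
      proof -
        have s: "l x > 0" "l y < 0" using xy by (auto simp: sign_conflicts_def)
        from less.prems(1) xy show ?thesis
        proof (cases rule: sign_conflicts_farey)
          case 1 then show ?thesis by auto
        next
          case 2 then show ?thesis using le[of a y] e s l[of a b] by auto
        next
          case 3 then show ?thesis using le[of x b] e s l[of a b] by auto
        qed
      qed
      have sub: "wide ?K \<subseteq> wide K - {(a, b)}" using new by (fastforce simp: wide_def)
      have "finite (wide K)"
        using finite_sign_conflicts[OF less.prems(1)] unfolding wide_def
        by (rule rev_finite_subset) auto
      then have "card (wide ?K) < card (wide K)"
        by (rule psubset_card_mono) (use sub ab in blast)
      moreover have "\<forall>(x, y)\<in>sign_conflicts l ?K. l x - l y \<le> int (Suc W)"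
        using new less.prems(2) by fastforce
      moreover have "fan ?K" using ref by (simp add: refines_def)
      ultimately obtain K' where "refines ?K K'" "sign_conflicts l K' = {}"
        using less.hyps[of ?K] by meson
      then show ?thesis using ref refines_trans by blast
    qed
  qed
qed

lemma refine_one:
  fixes l :: "int ^ 'm \<Rightarrow> int"
  assumes l: "\<And>v w. l (v + w) = l v + l w" and K: "fan K"
  shows "\<exists>K'. refines K K' \<and> sign_conflicts l K' = {}"
proof -
  \<comment> \<open>A crude bound: each width is at most the sum of all of them.\<close>
  let ?W = "\<Sum>(a, b)\<in>sign_conflicts l K. nat (l a - l b)"
  have "\<forall>(a, b)\<in>sign_conflicts l K. l a - l b \<le> int ?W"
  proof clarify
    fix a b assume "(a, b) \<in> sign_conflicts l K"
    from member_le_sum[OF this, of "\<lambda>(a, b). nat (l a - l b)"] finite_sign_conflicts[OF K]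
    have "nat (l a - l b) \<le> ?W" by auto
    then show "l a - l b \<le> int ?W" by linarith
  qed
  then show ?thesis using refine_bounded[OF l K] by blast
qed

lemma refine_all:
  fixes L :: "(int ^ 'm \<Rightarrow> int) set"
  assumes "finite L" "\<And>l v w. l \<in> L \<Longrightarrow> l (v + w) = l v + l w" "fan K"
  shows "\<exists>K'. refines K K' \<and> (\<forall>l\<in>L. sign_conflicts l K' = {})"
  using assms
proof (induction L)
  case empty
  then show ?case using refines_refl by blast
next
  case (insert l L)
  then obtain K' where K': "refines K K'" "\<forall>l\<in>L. sign_conflicts l K' = {}" by auto
  then obtain K'' where "refines K' K''" "sign_conflicts l K'' = {}"
    using refine_one[of l K'] insert.prems(1) by (auto simp: refines_def)
  moreover from this have "sign_conflicts l' K'' = {}" if "l' \<in> L" for l'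
    using that K' insert.prems(1)[of l'] by (auto simp: refines_def)
  ultimately show ?case
    using K' refines_trans by blast
qed

section \<open>Rational simplicial cones\<close>

lemma det_in_Rats:
  fixes A :: "real ^ 'm ^ 'm"
  assumes "\<And>i j. A $ i $ j \<in> \<rat>"
  shows "det A \<in> \<rat>"
  unfolding det_def by (intro Rats_sum Rats_mult Rats_prod assms) simp

text \<open>By Cramer's rule the entries of the inverse are quotients of determinants of rational
  matrices; \<open>R k l\<close> is \<open>A\<close> with column \<open>l\<close> replaced by the
  unit vector \<open>axis k 1\<close>.\<close>

lemma rational_inverse:
  fixes A :: "real ^ 'm ^ 'm"
  assumes rat: "\<And>i j. A $ i $ j \<in> \<rat>" and inv: "det A \<noteq> 0"
  obtains G :: "real ^ 'm ^ 'm" where "\<And>i j. G $ i $ j \<in> \<rat>" "A ** G = mat 1" "G ** A = mat 1"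
proof -
  define R :: "'m \<Rightarrow> 'm \<Rightarrow> real ^ 'm ^ 'm" where
    "R k l = (\<chi> i j. if j = l then (axis k 1 :: real ^ 'm) $ i else A $ i $ j)" for k l
  define G :: "real ^ 'm ^ 'm" where "G = (\<chi> l k. det (R k l) / det A)"
  have "A *v (\<chi> l. det (R k l) / det A) = axis k 1" for k
    using cramer[OF inv, of "\<chi> l. det (R k l) / det A" "axis k 1"] by (simp add: R_def)
  then have "A *v column k G = axis k 1" for k
    by (simp add: G_def column_def)
  then have "(A *v column k G) $ i = axis k 1 $ i" for i k by simp
  then have "(A ** G) $ i $ k = mat 1 $ i $ k" for i k
    by (simp add: matrix_vector_mult_def matrix_matrix_mult_def column_def axis_def mat_def)
  then have 1: "A ** G = mat 1" by (simp add: vec_eq_iff)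
  then have 2: "G ** A = mat 1" by (simp add: matrix_left_right_inverse)
  have "G $ i $ j \<in> \<rat>" for i j
    unfolding G_def
    by (auto intro!: Rats_divide det_in_Rats rat simp: R_def axis_def)
  then show thesis using that 1 2 by blast
qed

lemma common_denominator:
  assumes "finite X" "X \<subseteq> (\<rat> :: real set)"
  shows "\<exists>D::nat. D > 0 \<and> (\<forall>x\<in>X. real D * x \<in> \<int>)"
  using assms
proof (induction X)
  case (insert x X)
  then obtain D :: nat where D: "D > 0" "\<forall>x\<in>X. real D * x \<in> \<int>" by auto
  from insert.prems obtain m n :: int where mn: "n > 0" "x = m / n"
    by (metis Rats_cases' insert_subset)
  have "real (D * nat n) * y \<in> \<int>" if "y \<in> insert x X" for y
  proof (cases "y = x")
    case True
    then have "real (D * nat n) * y = real_of_int (int D * m)" using mn by simp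
    then show ?thesis by (metis Ints_of_int)
  next
    case False
    then have "real D * y \<in> \<int>" using D that by auto
    then have "real_of_int n * (real D * y) \<in> \<int>" by (rule Ints_mult[OF Ints_of_int])
    moreover have "real_of_int n * (real D * y) = real (D * nat n) * y" using mn by simp
    ultimately show ?thesis by simp
  qed
  moreover have "D * nat n > 0" using D mn by simp
  ultimately show ?case by blast
qed (auto intro: exI[of _ 1])

lemma det_nonzero_if_independent:
  fixes f :: "'m \<Rightarrow> real ^ 'm"
  assumes "inj f" "independent (range f)"
  shows "det (\<chi> i. f i) \<noteq> 0"
proof -
  have "\<forall>i. c i = 0" if "(\<Sum>i\<in>UNIV. c i *s row i (\<chi> i. f i)) = 0" for c
  proof -
    have "row i (\<chi> i. f i) = f i" for i by (simp add: row_def vec_eq_iff)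
    then have "(\<Sum>i\<in>UNIV. c i *\<^sub>R f i) = 0"
      using that by (simp add: scalar_mult_eq_scaleR)
    then have "(\<Sum>v\<in>range f. c (inv f v) *\<^sub>R v) = 0"
      using assms(1) by (simp add: sum.reindex)
    then have "c (inv f v) = 0" if "v \<in> range f" for v
      using independentD[OF assms(2) _ order_refl, of "\<lambda>v. c (inv f v)" v] that by simp
    then show ?thesis using assms(1) by (metis inv_f_f rangeI)
  qed
  then have "\<exists>B. (\<chi> i. f i) ** B = mat 1"
    unfolding matrix_right_invertible_independent_rows by blast
  then show ?thesis by (simp add: invertible_det_nz[symmetric] invertible_right_inverse)
qed

text \<open>The dual basis consists of the columns of the inverse matrix. The factor
  \<open>D\<close> clears their denominators, so that the coordinate functionals become
  integral.\<close>

lemma integral_dual_basis: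
  fixes f :: "'m \<Rightarrow> real ^ 'm"
  assumes nz: "det (\<chi> i. f i) \<noteq> 0" and rat: "\<And>i j. f i $ j \<in> \<rat>"
  obtains D :: nat and u :: "'m \<Rightarrow> int ^ 'm" where "D > 0"
    "\<And>i j. real_vec (u i) \<bullet> f j = (if i = j then real D else 0)"
    "\<And>y. real D *\<^sub>R y = (\<Sum>i\<in>UNIV. (real_vec (u i) \<bullet> y) *\<^sub>R f i)"
proof -
  define A where "A = (\<chi> i. f i)"
  have "det A \<noteq> 0" using nz by (simp add: A_def)
  then obtain G :: "real ^ 'm ^ 'm" where G: "\<And>i j. G $ i $ j \<in> \<rat>" "A ** G = mat 1" "G ** A = mat 1"
    using rational_inverse[of A] rat by (auto simp: A_def)
  have "finite (range (\<lambda>(i, j). G $ i $ j))" by simp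
  moreover have "range (\<lambda>(i, j). G $ i $ j) \<subseteq> \<rat>" using G(1) by auto
  ultimately obtain D :: nat where D: "D > 0" "\<And>i j. real D * G $ i $ j \<in> \<int>"
    using common_denominator by (metis (no_types, lifting) case_prod_conv rangeI)
  define u :: "'m \<Rightarrow> int ^ 'm" where "u i = (\<chi> j. \<lfloor>real D * G $ j $ i\<rfloor>)" for i
  have u: "real_vec (u i) $ j = real D * G $ j $ i" for i j
    using D(2)[of j i] by (auto simp: u_def elim!: Ints_cases)
  have inner_u: "real_vec (u i) \<bullet> y = real D * (\<Sum>j\<in>UNIV. y $ j * G $ j $ i)" for i y
    unfolding inner_vec_def u by (simp add: sum_distrib_left mult_ac)
  have "real_vec (u i) \<bullet> f j = (if i = j then real D else 0)" for i j
  proof -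
    have "(\<Sum>k\<in>UNIV. f j $ k * G $ k $ i) = (A ** G) $ j $ i"
      by (simp add: matrix_matrix_mult_def A_def)
    then show ?thesis by (simp add: inner_u G(2) mat_def)
  qed
  moreover have "real D *\<^sub>R y = (\<Sum>i\<in>UNIV. (real_vec (u i) \<bullet> y) *\<^sub>R f i)" for y
  proof -
    have "(\<Sum>i\<in>UNIV. (real_vec (u i) \<bullet> y) *\<^sub>R f i) = real D *\<^sub>R ((y v* G) v* A)"
      by (simp add: vec_eq_iff inner_u vector_matrix_mult_def A_def sum_distrib_left mult_ac)
    also have "(y v* G) v* A = y" by (simp add: vector_matrix_mul_assoc G(3))
    finally show ?thesis ..
  qed
  ultimately show thesis using that D(1) by blast
qed

text \<open>Extend \<open>C\<close> to a basis by standard unit vectors, which keeps it rational.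
  The cone consists of the points whose coordinates along \<open>C\<close> are nonnegative and whose
  other coordinates vanish, and the integral dual basis measures these coordinates.\<close>

lemma rational_simplicial_cone_halfspaces:
  fixes C :: "(real ^ 'm) set"
  assumes ind: "independent C" and rat: "\<And>v i. v \<in> C \<Longrightarrow> v $ i \<in> \<rat>"
  obtains L :: "(int ^ 'm) set" where "finite L"
    "\<And>y. (\<forall>u\<in>L. 0 \<le> real_vec u \<bullet> y) \<longleftrightarrow> (\<exists>c. (\<forall>v\<in>C. 0 \<le> c v) \<and> y = (\<Sum>v\<in>C. c v *\<^sub>R v))"
proof -
  obtain B where B: "C \<subseteq> B" "B \<subseteq> C \<union> Basis" "independent B" "C \<union> Basis \<subseteq> span B"
    using maximal_independent_subset_extend[of C "C \<union> Basis"] ind by auto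
  have "span B = UNIV"
    using span_mono[of Basis "span B"] B(4) span_Basis by (simp add: span_span top.extremum_unique)
  then have "card B = CARD('m)"
    using B(3) dim_eq_card_independent[of B] by (metis dim_UNIV dim_span DIM_cart DIM_real mult.right_neutral)
  moreover have "finite B" using B(3) independent_imp_finite by blast
  ultimately obtain f where f: "bij_betw f (UNIV :: 'm set) B"
    by (metis finite finite_same_card_bij)
  then have inj: "inj f" and range: "range f = B" by (auto simp: bij_betw_def)
  have "v $ i \<in> \<rat>" if "v \<in> B" for v i
    using that B(2) rat by (auto simp: Basis_vec_def axis_def)
  then have "f i $ j \<in> \<rat>" for i j using range by auto
  moreover have "det (\<chi> i. f i) \<noteq> 0" using det_nonzero_if_independent[OF inj] B(3) range by simp
  ultimately obtain D u where D: "D > (0::nat)"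
    and u: "\<And>i j. real_vec (u i) \<bullet> f j = (if i = j then real D else 0)"
    and y: "\<And>y. real D *\<^sub>R y = (\<Sum>i\<in>UNIV. (real_vec (u i) \<bullet> y) *\<^sub>R f i)"
    using integral_dual_basis[of f thesis] by blast
  \<comment> \<open>Outside \<open>C\<close> both signs of the functional are included, which forces
    the coordinate to be 0.\<close>
  define L where "L = range u \<union> (\<lambda>i. - u i) ` {i. f i \<notin> C}"
  have neg: "real_vec (- v) = - real_vec v" for v :: "int ^ 'm" by (simp add: vec_eq_iff)
  have finC: "finite C" using B \<open>finite B\<close> finite_subset by blast
  have sumC: "(\<Sum>v\<in>C. c v *\<^sub>R v) = (\<Sum>i\<in>UNIV. (if f i \<in> C then c (f i) else 0) *\<^sub>R f i)" for c
  proof -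
    have "(\<Sum>v\<in>C. c v *\<^sub>R v) = (\<Sum>v\<in>B. (if v \<in> C then c v else 0) *\<^sub>R v)"
      by (rule sum.mono_neutral_cong_left) (use B \<open>finite B\<close> in auto)
    then show ?thesis using inj by (simp add: range[symmetric] sum.reindex)
  qed
  show thesis
  proof (rule that[of L], goal_cases)
    case 1 show ?case by (simp add: L_def)
  next
    case (2 z)
    show ?case
    proof
      assume L: "\<forall>u\<in>L. 0 \<le> real_vec u \<bullet> z"
      define c where "c v = (real_vec (u (inv f v)) \<bullet> z) / real D" for v
      have pos: "0 \<le> real_vec (u i) \<bullet> z" for i using L by (auto simp: L_def)
      have zero: "real_vec (u i) \<bullet> z = 0" if "f i \<notin> C" for i
      proof -
        have "0 \<le> real_vec (- u i) \<bullet> z" using L that by (auto simp: L_def)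
        then show ?thesis using pos[of i] by (simp add: neg)
      qed
      have "z = (1 / real D) *\<^sub>R (real D *\<^sub>R z)" using D by simp
      also have "\<dots> = (\<Sum>i\<in>UNIV. ((real_vec (u i) \<bullet> z) / real D) *\<^sub>R f i)"
        unfolding y by (simp add: scaleR_sum_right)
      also have "\<dots> = (\<Sum>i\<in>UNIV. (if f i \<in> C then c (f i) else 0) *\<^sub>R f i)"
        by (rule sum.cong) (use zero inj in \<open>auto simp: c_def\<close>)
      also have "\<dots> = (\<Sum>v\<in>C. c v *\<^sub>R v)" by (simp add: sumC)
      finally show "\<exists>c. (\<forall>v\<in>C. 0 \<le> c v) \<and> z = (\<Sum>v\<in>C. c v *\<^sub>R v)"
        using pos by (intro exI[of _ c]) (auto simp: c_def)
    next
      assume "\<exists>c. (\<forall>v\<in>C. 0 \<le> c v) \<and> z = (\<Sum>v\<in>C. c v *\<^sub>R v)"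
      then obtain c where c: "\<forall>v\<in>C. 0 \<le> c v" "z = (\<Sum>v\<in>C. c v *\<^sub>R v)" by blast
      have "real_vec (u i) \<bullet> z = (\<Sum>j\<in>UNIV. if i = j then (if f j \<in> C then c (f j) else 0) * real D else 0)" for i
        unfolding c(2) sumC inner_sum_right inner_scaleR_right u by (rule sum.cong) auto
      then have "real_vec (u i) \<bullet> z = (if f i \<in> C then c (f i) * real D else 0)" for i
        by simp
      then show "\<forall>u\<in>L. 0 \<le> real_vec u \<bullet> z" using c(1) by (auto simp: L_def neg)
    qed
  qed
qed

section \<open>Homogeneous coordinates and cones over rational simplexes\<close>

definition hom1 :: "real ^ 'n \<Rightarrow> real ^ 'n option" where
  "hom1 x = (\<chi> j. case j of Some i \<Rightarrow> x $ i | None \<Rightarrow> 1)"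

lemma hom1_nth [simp]: "hom1 x $ Some i = x $ i" "hom1 x $ None = 1"
  by (simp_all add: hom1_def)

lemma vec_eq_option_iff:
  "x = y \<longleftrightarrow> x $ None = y $ None \<and> (\<forall>i. x $ Some i = y $ Some i)" for x y :: "'a ^ ('n :: finite) option"
  by (metis not_Some_eq vec_eq_iff)

lemma hom1_eq_iff [simp]: "hom1 x = hom1 y \<longleftrightarrow> x = y"
  by (simp add: vec_eq_option_iff vec_eq_iff)

lemma hom1_combination:
  assumes "sum c A = 1"
  shows "hom1 (\<Sum>v\<in>A. c v *\<^sub>R f v) = (\<Sum>v\<in>A. c v *\<^sub>R hom1 (f v))"
  using assms by (simp add: vec_eq_option_iff)

text \<open>The last coordinate of a linear relation among the lifted points says that the
  coefficients sum to 0.\<close>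

lemma affine_dependent_hom1:
  fixes S :: "(real ^ 'n) set"
  assumes "finite S"
  shows "affine_dependent S \<longleftrightarrow> dependent (hom1 ` S)"
proof -
  have inj: "inj_on hom1 S" by (auto simp: inj_on_def)
  have "(\<Sum>v\<in>S. U v *\<^sub>R hom1 v) = 0 \<longleftrightarrow> sum U S = 0 \<and> (\<Sum>v\<in>S. U v *\<^sub>R v) = 0" for U :: "real ^ 'n \<Rightarrow> real"
    by (auto simp: vec_eq_option_iff vec_eq_iff)
  then have 1: "affine_dependent S \<longleftrightarrow> (\<exists>U. (\<exists>v\<in>S. U v \<noteq> 0) \<and> (\<Sum>v\<in>S. U v *\<^sub>R hom1 v) = 0)"
    unfolding affine_dependent_explicit_finite[OF assms] by (simp only: conj_left_commute)
  have 2: "dependent (hom1 ` S) \<longleftrightarrow> (\<exists>U. (\<exists>v\<in>S. U (hom1 v) \<noteq> 0) \<and> (\<Sum>v\<in>S. U (hom1 v) *\<^sub>R hom1 v) = 0)"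
    using assms inj by (simp add: dependent_finite sum.reindex)
  show ?thesis
  proof
    assume "affine_dependent S"
    then obtain U where "\<exists>v\<in>S. U v \<noteq> 0" "(\<Sum>v\<in>S. U v *\<^sub>R hom1 v) = 0" unfolding 1 by blast
    then show "dependent (hom1 ` S)"
      unfolding 2 by (intro exI[of _ "\<lambda>y. U (inv hom1 y)"]) (simp add: inv_f_f inj_def)
  next
    assume "dependent (hom1 ` S)"
    then obtain U where U: "\<exists>v\<in>S. U (hom1 v) \<noteq> 0" "(\<Sum>v\<in>S. U (hom1 v) *\<^sub>R hom1 v) = 0"
      unfolding 2 by blast
    show "affine_dependent S" unfolding 1 by (rule exI[of _ "\<lambda>v. U (hom1 v)"]) (use U in simp)
  qed
qed

lemma den_exists:
  assumes "rational_point x"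
  shows "\<exists>d::nat. d > 0 \<and> (\<forall>i. real d * x $ i \<in> \<int>)"
  using common_denominator[of "range (\<lambda>i. x $ i)"] assms by (auto simp: rational_point_def)

lemma den_pos: "rational_point x \<Longrightarrow> den x > 0"
  and den_Ints: "rational_point x \<Longrightarrow> real (den x) * x $ i \<in> \<int>"
  using LeastI_ex[OF den_exists[of x]] by (auto simp: den_def)

lemma real_vec_homogeneous:
  assumes "rational_point x"
  shows "real_vec (homogeneous x) = real (den x) *\<^sub>R hom1 x"
proof -
  have "real_of_int \<lfloor>real (den x) * x $ i\<rfloor> = real (den x) * x $ i" for i
    using den_Ints[OF assms, of i] by (auto elim!: Ints_cases)
  then show ?thesis by (simp add: vec_eq_option_iff homogeneous_def)
qed

text \<open>Inverse to \<open>homogeneous\<close> on primitive vectors of positive height. At height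
  0 the division yields the zero vector, hence the positivity hypotheses below.\<close>

definition dehom :: "int ^ 'n option \<Rightarrow> real ^ 'n" where
  "dehom v = (\<chi> i. real_of_int (v $ Some i) / real_of_int (v $ None))"

lemma hom1_dehom: 
  "v $ None > 0 \<Longrightarrow> real_of_int (v $ None) *\<^sub>R hom1 (dehom v) = real_vec v"
  by (simp add: vec_eq_option_iff dehom_def)

lemma rational_point_dehom: "rational_point (dehom v)"
  by (simp add: rational_point_def dehom_def)

text \<open>A basis vector is primitive, so its last coordinate is the denominator of its dehomogenization.\<close>

lemma den_dehom:
  assumes B: "lattice_basis B" "v \<in> B" and pos: "v $ None > 0"
  shows "den (dehom v) = nat (v $ None)"
  unfolding den_def
proof (rule Least_equality, safe)
  show "0 < nat (v $ None)" using pos by simp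
  show "real (nat (v $ None)) * dehom v $ i \<in> \<int>" for i
    using pos by (simp add: dehom_def)
next
  fix d :: nat
  assume d: "d > 0" "\<forall>i. real d * dehom v $ i \<in> \<int>"
  define u :: "int ^ 'a option" where
    "u = (\<chi> j. case j of Some i \<Rightarrow> \<lfloor>real d * dehom v $ i\<rfloor> | None \<Rightarrow> int d)"
  have "real_of_int (u $ Some i) = real d * dehom v $ i" for i
    using d(2)[rule_format, of i] by (auto simp: u_def elim!: Ints_cases)
  then have "real_of_int (v $ None * u $ Some i) = real_of_int (int d * v $ Some i)" for i
    using pos by (simp add: dehom_def)
  then have eq: "v $ None *s u = int d *s v"
    unfolding vec_eq_option_iff of_int_eq_iff by (simp add: u_def)
  let ?r = "int_vec.representation B"
  have ind: "int_vec.independent B" and sp: "x \<in> int_vec.span B" for x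
    using B by (auto simp: lattice_basis_def)
  \<comment> \<open>Comparing the coefficients of the basis vector \<open>v\<close> on both sides of
    \<open>eq\<close> shows that the height of \<open>v\<close> divides \<open>d\<close>.\<close>
  have "v $ None * ?r u v = int d * ?r v v"
    using int_vec.representation_scale[OF ind sp, of "v $ None" u]
      int_vec.representation_scale[OF ind sp, of "int d" v] eq by metis
  then have "v $ None dvd int d"
    using int_vec.representation_basis[OF ind B(2)] by (metis dvd_triv_left mult.right_neutral)
  then show "nat (v $ None) \<le> d" using d(1) zdvd_imp_le[of "v $ None" "int d"] by simp
qed

lemma homogeneous_dehom:
  assumes "lattice_basis B" "v \<in> B" "v $ None > 0"
  shows "homogeneous (dehom v) = v"
  using assms(3) den_dehom[OF assms]
  by (simp add: vec_eq_option_iff homogeneous_def) (simp add: dehom_def)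

lemma vertices_convex_hull: "\<not> affine_dependent C \<Longrightarrow> vertices (convex hull C) = C"
  by (simp add: vertices_def extreme_point_of_convex_hull_affine_independent)

lemma rational_simplex_iff:
  "rational_simplex T \<longleftrightarrow> (\<exists>C. finite C \<and> \<not> affine_dependent C \<and> (\<forall>v\<in>C. rational_point v) \<and> T = convex hull C)"
proof
  assume "rational_simplex T"
  then obtain m C where "finite C" "\<not> affine_dependent C" "int (card C) = m + 1" "T = convex hull C"
    "\<forall>v\<in>vertices T. rational_point v"
    by (auto simp: rational_simplex_def simplex)
  then show "\<exists>C. finite C \<and> \<not> affine_dependent C \<and> (\<forall>v\<in>C. rational_point v) \<and> T = convex hull C"
    using vertices_convex_hull by blast
next
  assume "\<exists>C. finite C \<and> \<not> affine_dependent C \<and> (\<forall>v\<in>C. rational_point v) \<and> T = convex hull C"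
  then obtain C where "finite C" "\<not> affine_dependent C" "\<forall>v\<in>C. rational_point v" "T = convex hull C"
    by blast
  then show "rational_simplex T"
    using vertices_convex_hull[of C] simplex_convex_hull[of C "int (card C) - 1"]
    by (auto simp: rational_simplex_def)
qed

text \<open>These half-spaces cut out the cone over \<open>T\<close>. The origin is excepted since
  it has height 0 and is no positive multiple of a lifted point.\<close>

lemma rational_simplex_halfspaces:
  fixes T :: "(real ^ 'n) set"
  assumes "rational_simplex T"
  obtains L :: "(int ^ 'n option) set" where "finite L"
    "\<And>x u. x \<in> T \<Longrightarrow> u \<in> L \<Longrightarrow> 0 \<le> real_vec u \<bullet> hom1 x"
    "\<And>y. y \<noteq> 0 \<Longrightarrow> (\<And>u. u \<in> L \<Longrightarrow> 0 \<le> real_vec u \<bullet> y) \<Longrightarrow> \<exists>t x. t > 0 \<and> x \<in> T \<and> y = t *\<^sub>R hom1 x"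
proof -
  obtain C where C: "finite C" "\<not> affine_dependent C" "\<forall>v\<in>C. rational_point v" and T: "T = convex hull C"
    using assms unfolding rational_simplex_iff by blast
  have "independent (hom1 ` C)" using C affine_dependent_hom1 by blast
  moreover have "w $ j \<in> \<rat>" if "w \<in> hom1 ` C" for w and j :: "'n option"
    using that C(3) by (cases j) (auto simp: rational_point_def)
  ultimately obtain L :: "(int ^ 'n option) set" where L: "finite L"
    "\<And>y. (\<forall>u\<in>L. 0 \<le> real_vec u \<bullet> y) \<longleftrightarrow>
      (\<exists>c. (\<forall>v\<in>hom1 ` C. 0 \<le> c v) \<and> y = (\<Sum>v\<in>hom1 ` C. c v *\<^sub>R v))"
    by (rule rational_simplicial_cone_halfspaces) (assumption, rule that)
  have inj: "inj_on hom1 C" by (auto simp: inj_on_def)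
  show thesis
  proof (rule that[of L], goal_cases)
    case 1 show ?case by (fact L(1))
  next
    case (2 x u)
    then obtain c where c: "\<forall>v\<in>C. 0 \<le> c v" "sum c C = 1" "x = (\<Sum>v\<in>C. c v *\<^sub>R v)"
      unfolding T convex_hull_finite[OF C(1)] by auto
    then have "hom1 x = (\<Sum>v\<in>hom1 ` C. c (inv hom1 v) *\<^sub>R v)"
      using hom1_combination[OF c(2), of "\<lambda>v. v"] inj by (simp add: sum.reindex inv_f_f inj_def)
    moreover have "\<forall>v\<in>hom1 ` C. 0 \<le> c (inv hom1 v)"
      using c(1) by (auto simp: inv_f_f inj_def)
    ultimately have "\<forall>u\<in>L. 0 \<le> real_vec u \<bullet> hom1 x"
      unfolding L(2) by (intro exI[of _ "\<lambda>v. c (inv hom1 v)"] conjI)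
    then show ?case using 2(2) by blast
  next
    case (3 y)
    then have "\<forall>u\<in>L. 0 \<le> real_vec u \<bullet> y" by blast
    then obtain c where c: "\<forall>v\<in>hom1 ` C. 0 \<le> c v" "y = (\<Sum>v\<in>hom1 ` C. c v *\<^sub>R v)"
      unfolding L(2) by auto
    define d where "d v = c (hom1 v)" for v
    have y: "y = (\<Sum>v\<in>C. d v *\<^sub>R hom1 v)" using c(2) inj by (simp add: sum.reindex d_def)
    have d: "\<forall>v\<in>C. 0 \<le> d v" using c(1) by (simp add: d_def)
    have "sum d C \<noteq> 0"
    proof
      assume "sum d C = 0"
      then have "\<forall>v\<in>C. d v = 0" using d C(1) by (simp add: sum_nonneg_eq_0_iff)
      then show False using y 3(1) by simp
    qed
    then have pos: "sum d C > 0" using d by (simp add: sum_nonneg order_less_le)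
    \<comment> \<open>\<open>sum d C\<close> is the height of \<open>y\<close>, so dividing by it
      projects \<open>y\<close> to height 1.\<close>
    define x where "x = (\<Sum>v\<in>C. (d v / sum d C) *\<^sub>R v)"
    have s1: "(\<Sum>v\<in>C. d v / sum d C) = 1" using pos by (simp flip: sum_divide_distrib)
    have "x \<in> T"
      unfolding T convex_hull_finite[OF C(1)]
      using s1 d pos by (auto simp: x_def intro!: exI[of _ "\<lambda>v. d v / sum d C"])
    moreover have "sum d C *\<^sub>R hom1 x = y"
      unfolding x_def hom1_combination[OF s1, of "\<lambda>v. v"] y scaleR_sum_right
      using pos by (intro sum.cong) auto
    ultimately show ?case using pos by metis
  qed
qed

section \<open>Regular triangulations\<close>

text \<open>The cone spanned by \<open>corner N\<close> meets height 1 in the orthant where all coordinates are at least \<open>- N\<close>.\<close>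

definition corner :: "int \<Rightarrow> 'n option \<Rightarrow> int ^ ('n :: finite) option" where
  "corner N j = (case j of Some i \<Rightarrow> axis (Some i) 1 | None \<Rightarrow> (\<chi> k. if k = None then 1 else - N))"

lemma corner_nth [simp]:
  "corner N (Some i) $ Some k = of_bool (i = k)" "corner N (Some i) $ None = 0"
  "corner N None $ Some k = - N" "corner N None $ None = 1"
  by (auto simp: corner_def axis_def)

lemma sum_UNIV_option:
  "(\<Sum>j\<in>UNIV. f j) = f None + (\<Sum>i\<in>UNIV. f (Some i))" for f :: "('n :: finite) option \<Rightarrow> 'a :: comm_monoid_add"
proof -
  have "(\<Sum>j\<in>range Some. f j) = (\<Sum>i\<in>UNIV. f (Some i))" by (simp add: sum.reindex)
  then show ?thesis by (simp add: UNIV_option_conv)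
qed

lemma sum_of_bool_eq: "(\<Sum>i\<in>UNIV. f i * of_bool (i = k)) = f k" 
  for f :: "('n :: finite) \<Rightarrow> 'a :: semiring_1"
proof -
  have "(\<Sum>i\<in>UNIV. f i * of_bool (i = k)) = (\<Sum>i\<in>UNIV. if i = k then f i else 0)"
    by (rule sum.cong) auto
  then show ?thesis by simp
qed

lemma inj_corner: "inj (corner N)"
proof (rule injI)
  fix j k assume eq: "corner N j = corner N k"
  then have "corner N j $ i = corner N k $ i" for i by simp
  from this[of None] this[of j] this[of k] show "j = k"
    by (cases j; cases k) (simp_all split: if_splits)
qed

lemma corner_combination_nth:
  fixes c :: "int ^ ('n :: finite) option \<Rightarrow> int"
  shows "(\<Sum>v\<in>range (corner N). c v *s v) $ None = c (corner N None)"
    "(\<Sum>v\<in>range (corner N). c v *s v) $ Some k = c (corner N (Some k)) - N * c (corner N None)"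
  by (simp_all add: sum.reindex[OF inj_corner] sum_UNIV_option sum_of_bool_eq)

lemma corner_real_combination_nth:
  "(\<Sum>v\<in>range (corner N). c v *\<^sub>R real_vec v) $ None = c (corner N None)"
  "(\<Sum>v\<in>range (corner N). c v *\<^sub>R real_vec v) $ Some k = c (corner N (Some k)) - real_of_int N * c (corner N None)"
  by (simp_all add: sum.reindex[OF inj_corner] sum_UNIV_option sum_of_bool_eq)

text \<open>The system is unitriangular: the height determines the coefficient of
  \<open>corner N None\<close>, and each other coordinate then determines one further
  coefficient.\<close>

lemma lattice_basis_corner: "lattice_basis (range (corner N :: _ \<Rightarrow> int ^ ('n :: finite) option))"
  unfolding lattice_basis_def
proof
  let ?B = "range (corner N :: _ \<Rightarrow> int ^ 'n option)"
  show "int_vec.independent ?B"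
  proof
    assume "int_vec.dependent ?B"
    then obtain c where c: "\<exists>v\<in>?B. c v \<noteq> 0" "(\<Sum>v\<in>?B. c v *s v) = 0"
      using int_vec.dependent_finite[of ?B] by auto
    have n: "c (corner N None) = 0"
      unfolding corner_combination_nth(1)[symmetric] c(2) by simp
    have "c (corner N (Some k)) - N * c (corner N None) = 0" for k
      unfolding corner_combination_nth(2)[symmetric] c(2) by simp
    with n have "c (corner N j) = 0" for j by (cases j) auto
    then show False using c(1) by auto
  qed
  show "int_vec.span ?B = UNIV"
  proof (rule UNIV_eq_I[symmetric])
    fix x :: "int ^ 'n option"
    define c where "c v = (case inv (corner N) v of None \<Rightarrow> x $ None | Some i \<Rightarrow> x $ Some i + N * x $ None)" for v
    have "x = (\<Sum>v\<in>?B. c v *s v)"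
      unfolding vec_eq_option_iff corner_combination_nth by (simp add: c_def inv_f_f[OF inj_corner])
    moreover have "(\<Sum>v\<in>?B. c v *s v) \<in> int_vec.span ?B"
      by (intro int_vec.span_sum int_vec.span_scale int_vec.span_base)
    ultimately show "x \<in> int_vec.span ?B" by simp
  qed
qed

lemma fan_corner: "fan (Pow (range (corner N :: _ \<Rightarrow> int ^ ('n :: finite) option)))" (is "fan (Pow ?B)")
  unfolding fan_def
proof (intro conjI ballI allI impI)
  show "finite (Pow ?B)" by simp
  show "unimodular S" if "S \<in> Pow ?B" for S
    using that lattice_basis_corner finite_subset[of S ?B] unfolding unimodular_def by auto
  show "S' \<in> Pow ?B" if "S \<in> Pow ?B" "S' \<subseteq> S" for S S' using that by auto
  show "inj_on lin (Collect (conic_rep (Pow ?B)))"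
  proof (rule inj_onI)
    fix c d assume "c \<in> Collect (conic_rep (Pow ?B))" "d \<in> Collect (conic_rep (Pow ?B))"
      and eq: "lin c = lin d"
    then have supp: "{v. c v \<noteq> 0} \<subseteq> ?B" "{v. d v \<noteq> 0} \<subseteq> ?B" by (auto simp: conic_rep_def)
    then have "lin c = (\<Sum>v\<in>?B. c v *\<^sub>R real_vec v)" "lin d = (\<Sum>v\<in>?B. d v *\<^sub>R real_vec v)"
      by (simp_all add: lin_eq_sum)
    then have eq: "(\<Sum>v\<in>?B. c v *\<^sub>R real_vec v) $ j = (\<Sum>v\<in>?B. d v *\<^sub>R real_vec v) $ j" for j
      using eq by simp
    have n: "c (corner N None) = d (corner N None)"
      using eq[of None] unfolding corner_real_combination_nth .
    have "c (corner N (Some k)) = d (corner N (Some k))" for k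
      using eq[of "Some k"] n unfolding corner_real_combination_nth by simp
    with n have on: "c (corner N j) = d (corner N j)" for j by (cases j) auto
    show "c = d"
    proof
      fix v show "c v = d v"
      proof (cases "v \<in> ?B")
        case True
        then show ?thesis using on by blast
      next
        case False
        then have "c v = 0" "d v = 0" using supp by blast+
        then show ?thesis by simp
      qed
    qed
  qed
qed

lemma fan_support_corner:
  assumes "\<And>i. - real_of_int N \<le> x $ i"
  shows "hom1 x \<in> fan_support (Pow (range (corner N)))"
proof -
  \<comment> \<open>These are the coordinates of \<open>hom1 x\<close> in the corner basis; the
    shift by \<open>N\<close> makes them nonnegative.\<close>
  define c where "c v = (if v \<in> range (corner N) then
      (case inv (corner N) v of None \<Rightarrow> 1 | Some i \<Rightarrow> x $ i + real_of_int N) else 0)" for v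
  have supp: "{v. c v \<noteq> 0} \<subseteq> range (corner N)" by (auto simp: c_def)
  have "0 \<le> c v" for v
  proof (cases "v \<in> range (corner N)")
    case True
    then obtain j where "v = corner N j" by auto
    moreover have "0 \<le> x $ i + real_of_int N" for i using assms[of i] by simp
    ultimately show ?thesis by (cases j) (auto simp: c_def inv_f_f[OF inj_corner])
  qed (simp add: c_def)
  then have "conic_rep (Pow (range (corner N))) c" using supp by (simp add: conic_rep_def)
  moreover have "lin c = hom1 x"
    unfolding vec_eq_option_iff lin_eq_sum[OF _ supp, simplified] corner_real_combination_nth
    by (simp add: c_def inv_f_f[OF inj_corner])
  ultimately show ?thesis unfolding fan_support_def by (metis imageI mem_Collect_eq)
qed

section \<open>Cutting the cones of a fan at height 1\<close>

text \<open>Conic coefficients and convex weights differ by the height of the generator: the weight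
  of \<open>dehom v\<close> is \<open>c v * v $ None\<close>, and these weights sum to 1 because
  \<open>hom1 x\<close> has height 1.\<close>

lemma convex_hull_dehom_iff:
  fixes S :: "(int ^ ('n :: finite) option) set"
  assumes fin: "finite S" and pos: "\<And>v. v \<in> S \<Longrightarrow> 0 < v $ None"
  shows "x \<in> convex hull (dehom ` S) \<longleftrightarrow>
    (\<exists>c. (\<forall>v. 0 \<le> c v) \<and> {v. c v \<noteq> 0} \<subseteq> S \<and> lin c = hom1 x)" (is "_ \<longleftrightarrow> ?P x")
proof
  have "convex hull (dehom ` S) \<subseteq> Collect ?P"
  proof (rule hull_minimal)
    show "dehom ` S \<subseteq> Collect ?P"
    proof safe
      fix v assume v: "v \<in> S"
      let ?c = "\<lambda>w. if w = v then 1 / real_of_int (v $ None) else 0"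
      have "lin ?c = (1 / real_of_int (v $ None)) *\<^sub>R real_vec v"
        by (subst lin_eq_sum[of "{v}"]) auto
      also have "\<dots> = hom1 (dehom v)" using hom1_dehom[OF pos[OF v]] pos[OF v]
        by (simp flip: hom1_dehom[OF pos[OF v]])
      finally show "?P (dehom v)"
        using v pos[OF v] by (intro exI[of _ ?c]) auto
    qed
    show "convex (Collect ?P)"
    proof (rule convexI, clarify, goal_cases)
      case (1 x y s t c d)
      let ?e = "\<lambda>v. s * c v + t * d v"
      have e: "finite {v. c v \<noteq> 0}" "finite {v. d v \<noteq> 0}" "finite {v. s * c v \<noteq> 0}"
        using 1 fin by (auto intro: finite_subset rev_finite_subset[of "{v. c v \<noteq> 0}"])
      have "lin (\<lambda>v. 0 + s * c v) = s *\<^sub>R lin c"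
        using lin_add_scale[of "\<lambda>v. 0" c s] e by (simp add: lin_def)
      then have "lin ?e = s *\<^sub>R lin c + t *\<^sub>R lin d"
        using lin_add_scale[OF e(3,2), of t] by simp
      also have "\<dots> = hom1 (s *\<^sub>R x + t *\<^sub>R y)"
        using 1 by (simp add: vec_eq_option_iff)
      finally have "lin ?e = hom1 (s *\<^sub>R x + t *\<^sub>R y)" .
      moreover have "{v. ?e v \<noteq> 0} \<subseteq> {v. c v \<noteq> 0} \<union> {v. d v \<noteq> 0}" by auto
      then have "{v. ?e v \<noteq> 0} \<subseteq> S" using 1 by blast
      ultimately show ?case using 1 by (intro exI[of _ ?e]) auto
    qed
  qed
  then show "x \<in> convex hull (dehom ` S) \<Longrightarrow> ?P x" by auto
next
  assume "?P x"
  then obtain c where c: "\<And>v. 0 \<le> c v" "{v. c v \<noteq> 0} \<subseteq> S" "lin c = hom1 x" by auto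
  have eq: "hom1 x = (\<Sum>v\<in>S. c v *\<^sub>R real_vec v)" using lin_eq_sum[OF fin c(2)] c(3) by simp
  define m where "m v = c v * real_of_int (v $ None)" for v
  have "sum m S = 1"
    using arg_cong[OF eq, of "\<lambda>y. y $ None"] by (simp add: m_def)
  moreover have "hom1 x = (\<Sum>v\<in>S. m v *\<^sub>R hom1 (dehom v))"
    unfolding eq m_def by (rule sum.cong) (simp_all add: hom1_dehom[OF pos, symmetric])
  ultimately have "x = (\<Sum>v\<in>S. m v *\<^sub>R dehom v)"
    using hom1_combination[of m S dehom] by (metis hom1_eq_iff)
  moreover have "(\<Sum>v\<in>S. m v *\<^sub>R dehom v) \<in> convex hull (dehom ` S)"
    by (rule convex_sum) (use fin \<open>sum m S = 1\<close> c(1) pos in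
      \<open>auto simp: m_def less_imp_le hull_inc\<close>)
  ultimately show "x \<in> convex hull (dehom ` S)" by simp
qed

text \<open>No ray at infinity, so the section at height 1 is bounded, with one vertex on each
  ray.\<close>

definition positive_cone :: "(int ^ ('n :: finite) option) set \<Rightarrow> bool" where
  "positive_cone S \<longleftrightarrow> (\<forall>v\<in>S. 0 < v $ None)"

context
  fixes K :: "(int ^ ('n :: finite) option) set set"
  assumes fan: "fan K"
begin

lemma inj_lin: "inj_on lin (Collect (conic_rep K))"
  using fan by (simp add: fan_def)

lemma homogeneous_dehom_fan:
  assumes "S \<in> K" "positive_cone S" "v \<in> S"
  shows "homogeneous (dehom v) = v"
proof -
  obtain B where "lattice_basis B" "S \<subseteq> B"
    using fan assms(1) unfolding fan_def unimodular_def by blast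
  then show ?thesis using homogeneous_dehom[of B v] assms by (auto simp: positive_cone_def)
qed

lemma homogeneous_dehom_image:
  assumes "S \<in> K" "positive_cone S"
  shows "homogeneous ` dehom ` S = S"
  using homogeneous_dehom_fan[OF assms] by force

lemma conic_rep_subset:
  assumes "S \<in> K" "\<forall>v. 0 \<le> c v" "{v. c v \<noteq> 0} \<subseteq> S"
  shows "conic_rep K c"
  using assms fan_subset[OF fan] by (simp add: conic_rep_def)

text \<open>A common point has a representation supported in \<open>S\<close> and one supported in
  \<open>T\<close>. By injectivity of \<open>lin\<close> they coincide, so the support lies in
  \<open>S \<inter> T\<close>.\<close>

lemma convex_hull_dehom_Int:
  assumes S: "S \<in> K" "positive_cone S" and T: "T \<in> K" "positive_cone T"
  shows "convex hull (dehom ` S) \<inter> convex hull (dehom ` T) = convex hull (dehom ` (S \<inter> T))"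
proof
  show "convex hull (dehom ` (S \<inter> T)) \<subseteq> convex hull (dehom ` S) \<inter> convex hull (dehom ` T)"
    by (intro Int_greatest hull_mono) auto
  show "convex hull (dehom ` S) \<inter> convex hull (dehom ` T) \<subseteq> convex hull (dehom ` (S \<inter> T))"
  proof clarify
    fix x assume x: "x \<in> convex hull (dehom ` S)" "x \<in> convex hull (dehom ` T)"
    have fin: "finite S" "finite T" "finite (S \<inter> T)" using fan_finite[OF fan] S T by auto
    obtain c where c: "\<forall>v. 0 \<le> c v" "{v. c v \<noteq> 0} \<subseteq> S" "lin c = hom1 x"
      using x(1) convex_hull_dehom_iff[OF fin(1)] S(2) by (auto simp: positive_cone_def)
    obtain d where d: "\<forall>v. 0 \<le> d v" "{v. d v \<noteq> 0} \<subseteq> T" "lin d = hom1 x"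
      using x(2) convex_hull_dehom_iff[OF fin(2)] T(2) by (auto simp: positive_cone_def)
    have "c = d"
      by (rule inj_onD[OF inj_lin]) (use conic_rep_subset S T c d in auto)
    then have "{v. c v \<noteq> 0} \<subseteq> S \<inter> T" using c d by simp
    then show "x \<in> convex hull (dehom ` (S \<inter> T))"
      using c convex_hull_dehom_iff[OF fin(3)] S(2) by (auto simp: positive_cone_def)
  qed
qed

text \<open>Injectivity of \<open>lin\<close> speaks of nonnegative coefficients only, so it is
  applied to the positive and the negative part of \<open>U\<close>.\<close>

lemma real_vec_independent:
  assumes "S \<in> K" "(\<Sum>v\<in>S. U v *\<^sub>R real_vec v) = 0" "v \<in> S"
  shows "U v = 0"
proof -
  define c where "c w = (if w \<in> S then max (U w) 0 else 0)" for w
  define d where "d w = (if w \<in> S then max (- U w) 0 else 0)" for w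
  have fin: "finite S" using fan_finite fan assms(1) by blast
  have "lin c - lin d = (\<Sum>v\<in>S. c v *\<^sub>R real_vec v) - (\<Sum>v\<in>S. d v *\<^sub>R real_vec v)"
    using fin by (subst (1 2) lin_eq_sum[of S]) (auto simp: c_def d_def)
  also have "\<dots> = (\<Sum>v\<in>S. U v *\<^sub>R real_vec v)"
    unfolding sum_subtractf[symmetric] scaleR_diff_left[symmetric]
    by (rule sum.cong) (auto simp: c_def d_def max_def)
  finally have "lin c = lin d" using assms(2) by simp
  then have "c = d"
  proof (rule inj_onD[OF inj_lin])
    show "c \<in> Collect (conic_rep K)"
      by (simp, rule conic_rep_subset[OF assms(1)]) (auto simp: c_def)
    show "d \<in> Collect (conic_rep K)"
      by (simp, rule conic_rep_subset[OF assms(1)]) (auto simp: d_def)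
  qed
  from fun_cong[OF this, of v] assms(3) show ?thesis by (auto simp: c_def d_def max_def split: if_splits)
qed

text \<open>Dividing the coefficients by the heights turns an affine relation among the section
  points into a linear relation among the generators.\<close>

lemma affine_independent_dehom:
  assumes S: "S \<in> K" "positive_cone S"
  shows "\<not> affine_dependent (dehom ` S)"
proof
  have fin: "finite S" using fan_finite fan S by blast
  have inj: "inj_on dehom S"
    by (rule inj_on_inverseI[of _ homogeneous]) (rule homogeneous_dehom_fan[OF S])
  assume "affine_dependent (dehom ` S)"
  then obtain U where U: "sum U (dehom ` S) = 0" "\<exists>v\<in>dehom ` S. U v \<noteq> 0" 
      "(\<Sum>v\<in>dehom ` S. U v *\<^sub>R v) = 0"
    using affine_dependent_explicit_finite[of "dehom ` S"] fin by auto
  have "(\<Sum>v\<in>S. (U (dehom v) / real_of_int (v $ None)) *\<^sub>R real_vec v) = (\<Sum>v\<in>S. U (dehom v) *\<^sub>R hom1 (dehom v))"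
  proof (rule sum.cong)
    fix v assume "v \<in> S"
    then have p: "0 < v $ None" using S by (auto simp: positive_cone_def)
    show "(U (dehom v) / real_of_int (v $ None)) *\<^sub>R real_vec v = U (dehom v) *\<^sub>R hom1 (dehom v)"
      using p by (simp flip: hom1_dehom[OF p])
  qed simp
  also have "\<dots> = 0"
    using U(1,3) inj by (simp add: vec_eq_option_iff sum.reindex) (simp add: vec_eq_iff)
  finally have "U (dehom v) / real_of_int (v $ None) = 0" if "v \<in> S" for v
    using real_vec_independent[OF S(1) _ that, of "\<lambda>v. U (dehom v) / real_of_int (v $ None)"] by simp
  then have "U (dehom v) = 0" if "v \<in> S" for v
    using S that by (force simp: positive_cone_def)
  then show False using U(2) by blast
qed

lemma regular_simplex_dehom:
  assumes S: "S \<in> K" "positive_cone S"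
  shows "regular_simplex (convex hull (dehom ` S))"
proof -
  note ind = affine_independent_dehom[OF S]
  have "rational_simplex (convex hull (dehom ` S))"
    using ind fan_finite[OF fan S(1)] rational_point_dehom unfolding rational_simplex_iff by blast
  moreover obtain B where "lattice_basis B" "S \<subseteq> B"
    using fan S(1) unfolding fan_def unimodular_def by blast
  ultimately show ?thesis
    unfolding regular_simplex_def vertices_convex_hull[OF ind] homogeneous_dehom_image[OF S] by blast
qed

text \<open>Stated for a part \<open>M\<close> of the fan, because other cones may have rays at
  infinity or leave the polyhedron. Faces of a section correspond to subsets of its generators, so
  closure under subsets gives closure under faces.\<close>

lemma simplicial_complex_dehom:
  assumes sub: "M \<subseteq> K" and closed: "\<And>S S'. S \<in> M \<Longrightarrow> S' \<subseteq> S \<Longrightarrow> S' \<in> M"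
    and pos: "\<And>S. S \<in> M \<Longrightarrow> positive_cone S"
  shows "simplicial_complex ((\<lambda>S. convex hull (dehom ` S)) ` M)"
  unfolding simplicial_complex_def
proof (intro conjI ballI allI impI; (elim conjE imageE)?)
  show "finite ((\<lambda>S. convex hull (dehom ` S)) ` M)"
    using sub fan by (auto simp: fan_def intro: finite_subset)
next
  fix T S assume "T = convex hull (dehom ` S)" "S \<in> M"
  then show "\<exists>n. n simplex T"
    using regular_simplex_dehom[of S] sub pos by (auto simp: regular_simplex_def rational_simplex_def)
next
  fix F T S assume "F face_of T" "T = convex hull (dehom ` S)" and S: "S \<in> M"
  then have "F face_of convex hull (dehom ` S)" by simp
  moreover have "\<not> affine_dependent (dehom ` S)"
    using affine_independent_dehom S sub pos by blast
  ultimately obtain C where C: "C \<subseteq> dehom ` S" "F = convex hull C"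
    using face_of_convex_hull_affine_independent by blast
  then obtain S' where "S' \<subseteq> S" "C = dehom ` S'" by (auto simp: subset_image_iff)
  then show "F \<in> (\<lambda>S. convex hull (dehom ` S)) ` M" using C closed S by auto
next
  fix T T' S S' assume *: "T = convex hull (dehom ` S)" "S \<in> M" "T' = convex hull (dehom ` S')" "S' \<in> M"
  have "T \<inter> T' = convex hull (dehom ` (S \<inter> S'))"
    using convex_hull_dehom_Int[of S S'] sub pos * by auto
  moreover have "\<not> affine_dependent (dehom ` S)"
    using affine_independent_dehom * sub pos by blast
  then have "convex hull (dehom ` (S \<inter> S')) face_of convex hull (dehom ` S)"
    by (subst face_of_convex_hull_affine_independent, assumption)
      (rule exI[of _ "dehom ` (S \<inter> S')"], auto)
  ultimately show "T \<inter> T' face_of T" using * by simp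
qed

end

section \<open>Assembling a regular triangulation of a rational polyhedron\<close>

definition pairing :: "int ^ 'm \<Rightarrow> int ^ 'm \<Rightarrow> int" where
  "pairing u v = (\<Sum>i\<in>UNIV. u $ i * v $ i)"

lemma real_pairing: "real_vec u \<bullet> real_vec v = real_of_int (pairing u v)"
  by (simp add: pairing_def inner_vec_def)

lemma pairing_add: "pairing u (v + w) = pairing u v + pairing u w"
  by (simp add: pairing_def distrib_left sum.distrib)

lemma rational_polyhedron_lower_bound:
  assumes "rational_polyhedron P"
  obtains N :: int where "\<And>x i. x \<in> P \<Longrightarrow> - real_of_int N \<le> x $ i"
proof -
  obtain F where F: "finite F" "\<And>T. T \<in> F \<Longrightarrow> rational_simplex T" "P = \<Union>F"
    using assms by (auto simp: rational_polyhedron_def)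
  have "bounded T" if "T \<in> F" for T
    using F(2)[OF that] polytope_imp_bounded simplex_imp_polytope by (auto simp: rational_simplex_def)
  then have "bounded P" using F by (simp add: bounded_Union)
  then obtain b where b: "\<And>x. x \<in> P \<Longrightarrow> norm x \<le> b" by (auto simp: bounded_iff)
  show thesis
  proof (rule that[of "\<lceil>b\<rceil>"])
    fix x i assume "x \<in> P"
    then show "- real_of_int \<lceil>b\<rceil> \<le> x $ i"
      using b[of x] component_le_norm_cart[of x i] by linarith
  qed
qed

text \<open>If one generator in the support were strictly negative, the absence of conflicts would
  leave none positive, and a combination in which that generator has positive weight would be
  strictly negative.\<close>

lemma coherent_sign:
  assumes "fan K" "sign_conflicts (pairing u) K = {}" "conic_rep K c" "0 \<le> real_vec u \<bullet> lin c" "c v \<noteq> 0"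
  shows "0 \<le> pairing u v"
proof (rule ccontr)
  assume "\<not> 0 \<le> pairing u v"
  then have neg: "pairing u v < 0" by simp
  have c: "0 \<le> c w" for w using assms(3) by (simp add: conic_rep_def)
  have K: "{w. c w \<noteq> 0} \<in> K" using assms(3) by (simp add: conic_rep_def)
  have le: "pairing u w \<le> 0" if "c w \<noteq> 0" for w
  proof (rule ccontr)
    assume "\<not> pairing u w \<le> 0"
    moreover have "{w, v} \<in> K" using fan_subset[OF assms(1) K, of "{w, v}"] that assms(5) by auto
    ultimately have "(w, v) \<in> sign_conflicts (pairing u) K" using neg by (simp add: sign_conflicts_def)
    then show False using assms(2) by simp
  qed
  have "real_vec u \<bullet> lin c = (\<Sum>w | c w \<noteq> 0. c w * real_of_int (pairing u w))"
    by (simp add: inner_lin real_pairing)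
  then have "- (real_vec u \<bullet> lin c) = (\<Sum>w | c w \<noteq> 0. - (c w * real_of_int (pairing u w)))"
    by (simp add: sum_negf)
  also have "\<dots> > 0"
  proof (rule sum_pos2[where i = v])
    show "finite {w. c w \<noteq> 0}" using fan_finite[OF assms(1) K] .
    show "0 < - (c v * real_of_int (pairing u v))"
      using mult_pos_neg[of "c v" "real_of_int (pairing u v)"] c[of v] neg assms(5) by simp
    show "0 \<le> - (c w * real_of_int (pairing u w))" if "w \<in> {w. c w \<noteq> 0}" for w
      using c[of w] le[of w] that by (simp add: mult_nonneg_nonpos)
  qed (use assms(5) in simp)
  finally show False using assms(4) by simp
qed

theorem regular_triangulation_exists:
  fixes P :: "(real ^ 'n) set"
  assumes "rational_polyhedron P"
  shows "\<exists>\<Delta>. regular_triangulation \<Delta> P"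
proof -
  obtain N where N: "\<And>x i. x \<in> P \<Longrightarrow> - real_of_int N \<le> x $ i"
    by (rule rational_polyhedron_lower_bound[OF assms]) (rule that)
  obtain F where F: "finite F" "\<And>T. T \<in> F \<Longrightarrow> rational_simplex T" "P = \<Union>F"
    using assms by (auto simp: rational_polyhedron_def)
  define good where "good T L \<longleftrightarrow> finite L \<and> (\<forall>x\<in>T. \<forall>u\<in>L. 0 \<le> real_vec u \<bullet> hom1 x) \<and>
    (\<forall>y. y \<noteq> 0 \<longrightarrow> (\<forall>u\<in>L. 0 \<le> real_vec u \<bullet> y) \<longrightarrow> (\<exists>t x. t > 0 \<and> x \<in> T \<and> y = t *\<^sub>R hom1 x))"
    for T :: "(real ^ 'n) set" and L :: "(int ^ 'n option) set"
  have "\<exists>L. good T L" if T: "T \<in> F" for T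
  proof (rule rational_simplex_halfspaces[OF F(2)[OF T]])
    fix L :: "(int ^ 'n option) set"
    assume "finite L"
      "\<And>x u. x \<in> T \<Longrightarrow> u \<in> L \<Longrightarrow> 0 \<le> real_vec u \<bullet> hom1 x"
      "\<And>y. y \<noteq> 0 \<Longrightarrow> (\<And>u. u \<in> L \<Longrightarrow> 0 \<le> real_vec u \<bullet> y) \<Longrightarrow> \<exists>t x. t > 0 \<and> x \<in> T \<and> y = t *\<^sub>R hom1 x"
    then have "good T L" unfolding good_def by simp
    then show ?thesis ..
  qed
  then obtain L where L: "\<And>T. T \<in> F \<Longrightarrow> good T (L T)" by metis
  let ?K0 = "Pow (range (corner N :: _ \<Rightarrow> int ^ 'n option))"
  have additive: "l (v + w) = l v + l w" if "l \<in> pairing ` (\<Union>T\<in>F. L T)" for l v w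
    using that by (auto simp: pairing_add)
  have "finite (pairing ` (\<Union>T\<in>F. L T))" using F(1) L by (auto simp: good_def)
  then obtain K where K: "refines ?K0 K" "\<forall>l\<in>pairing ` (\<Union>T\<in>F. L T). sign_conflicts l K = {}"
    using refine_all[OF _ additive fan_corner] by blast
  then have fan: "fan K" and supp: "fan_support ?K0 \<subseteq> fan_support K" by (auto simp: refines_def)
  \<comment> \<open>Containment in a simplex of \<open>P\<close> is asked of the vertices only;
    convexity extends it to the whole section.\<close>
  define M where "M = {S \<in> K. positive_cone S \<and> (\<exists>T\<in>F. dehom ` S \<subseteq> T)}"
  define \<Delta> where "\<Delta> = (\<lambda>S. convex hull (dehom ` S)) ` M"
  have "simplicial_complex \<Delta>"
    unfolding \<Delta>_def
  proof (rule simplicial_complex_dehom[OF fan])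
    show "S' \<in> M" if "S \<in> M" "S' \<subseteq> S" for S S'
    proof -
      from \<open>S \<in> M\<close> obtain T where T: "S \<in> K" "positive_cone S" "T \<in> F" "dehom ` S \<subseteq> T"
        by (auto simp: M_def)
      then have "S' \<in> K" using fan_subset[OF fan] that(2) by blast
      moreover have "positive_cone S'" using T(2) that(2) by (auto simp: positive_cone_def)
      moreover have "dehom ` S' \<subseteq> T" using T(4) that(2) by blast
      ultimately show ?thesis using T(3) unfolding M_def by blast
    qed
  qed (auto simp: M_def)
  moreover have "\<forall>T\<in>\<Delta>. regular_simplex T"
    using regular_simplex_dehom[OF fan] by (auto simp: \<Delta>_def M_def)
  moreover have "\<Union>\<Delta> = P"
  proof
    show "\<Union>\<Delta> \<subseteq> P"
    proof
      fix x assume "x \<in> \<Union>\<Delta>"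
      then obtain S T where S: "x \<in> convex hull (dehom ` S)" "T \<in> F" "dehom ` S \<subseteq> T"
        by (auto simp: \<Delta>_def M_def)
      moreover have "convex T"
        using F(2)[OF S(2)] convex_simplex by (auto simp: rational_simplex_def)
      ultimately have "x \<in> T" using hull_minimal[of "dehom ` S" T convex] by blast
      then show "x \<in> P" using F(3) S(2) by blast
    qed
    show "P \<subseteq> \<Union>\<Delta>"
    proof
      fix x assume x: "x \<in> P"
      then obtain T where T: "T \<in> F" "x \<in> T" using F(3) by auto
      have "hom1 x \<in> fan_support K" using fan_support_corner[of N x] N[OF x] supp by auto
      then obtain c where c: "conic_rep K c" "lin c = hom1 x" by (auto simp: fan_support_def)
      \<comment> \<open>The support is the smallest cone containing \<open>hom1 x\<close>. Each of
        its generators has positive weight, so \<open>coherent_sign\<close> applies to all of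
        them.\<close>
      define S where "S = {v. c v \<noteq> 0}"
      have S: "S \<in> K" "finite S" using c(1) fan_finite[OF fan] by (auto simp: conic_rep_def S_def)
      have v: "0 < v $ None \<and> dehom v \<in> T" if v: "v \<in> S" for v
      proof -
        have "0 \<le> real_vec u \<bullet> real_vec v" if u: "u \<in> L T" for u
        proof -
          have "0 \<le> real_vec u \<bullet> lin c" unfolding c(2) using L[OF T(1)] T(2) u by (auto simp: good_def)
          moreover have "sign_conflicts (pairing u) K = {}" using K(2) T(1) u by blast
          ultimately have "0 \<le> pairing u v"
            using coherent_sign[OF fan _ c(1)] v by (simp add: S_def)
          then show ?thesis by (simp add: real_pairing)
        qed
        \<comment> \<open>The half-spaces in \<open>L T\<close> describe the cone over
          \<open>T\<close> only away from the origin.\<close>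
        moreover have "real_vec v \<noteq> 0"
          using real_vec_independent[OF fan S(1), of "\<lambda>w. of_bool (w = v)" v] v S(2)
          by (auto simp: if_distrib[of "\<lambda>t. t *\<^sub>R _"] of_bool_def cong: if_cong)
        ultimately obtain t y where y: "t > 0" "y \<in> T" "real_vec v = t *\<^sub>R hom1 y"
          using L[OF T(1)] unfolding good_def by blast
        then have t: "real_of_int (v $ None) = t" by (simp add: vec_eq_option_iff)
        then have "dehom v = y" using y by (simp add: vec_eq_option_iff vec_eq_iff dehom_def)
        then show ?thesis using t y by simp
      qed
      then have "x \<in> convex hull (dehom ` S)"
        using convex_hull_dehom_iff[OF S(2)] c by (auto simp: conic_rep_def S_def)
      moreover have "S \<in> M" using v S(1) T(1) unfolding M_def positive_cone_def by blast
      ultimately show "x \<in> \<Union>\<Delta>" unfolding \<Delta>_def by blast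
    qed
  qed
  ultimately show ?thesis unfolding regular_triangulation_def by blast
qed

section \<open>Volume of regular simplexes\<close>

text \<open>Column \<open>z\<close> vanishes off the diagonal, so only permutations fixing
  \<open>z\<close> contribute, and these are carried along \<open>f\<close>. Naming the remaining
  indices by \<open>f\<close> lets the minor have an index type of its own.\<close>

lemma det_block:
  fixes A :: "'a :: comm_ring_1 ^ 'm ^ 'm" and f :: "'k :: finite \<Rightarrow> 'm"
  assumes f: "inj f" "range f = UNIV - {z}" and zero: "\<And>i. A $ f i $ z = 0"
  shows "det A = A $ z $ z * det (\<chi> i j. A $ f i $ f j)"
proof -
  have bij: "bij_betw f UNIV (UNIV - {z})" using f by (simp add: bij_betw_def)
  let ?m = "map_permutation UNIV f"
  have m_eq: "?m p x = (if x \<in> UNIV - {z} then f (p (inv_into UNIV f x)) else x)" for p x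
    using f by (simp add: map_permutation_def restrict_id_def)
  have bijm: "bij_betw ?m {p. p permutes UNIV} {p. p permutes UNIV - {z}}"
    using bij_betw_permutations[OF bij] by (simp add: m_eq[abs_def] fun_eq_iff cong: bij_betw_cong)
  let ?g = "\<lambda>p. of_int (sign p) * (\<Prod>i\<in>UNIV. A $ i $ p i)"
  have split: "(\<Prod>i\<in>UNIV. A $ i $ p i) = A $ z $ p z * (\<Prod>i\<in>UNIV. A $ f i $ p (f i))" for p
  proof -
    have "(\<Prod>i\<in>UNIV. A $ i $ p i) = A $ z $ p z * (\<Prod>i\<in>UNIV - {z}. A $ i $ p i)"
      by (rule prod.remove) auto
    also have "(\<Prod>i\<in>UNIV - {z}. A $ i $ p i) = (\<Prod>i\<in>UNIV. A $ f i $ p (f i))"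
      using prod.reindex_bij_betw[OF bij, of "\<lambda>i. A $ i $ p i"] by simp
    finally show ?thesis .
  qed
  have "det A = sum ?g {p. p permutes UNIV}" by (simp add: det_def)
  also have "\<dots> = sum ?g {p. p permutes UNIV - {z}}"
  proof (rule sum.mono_neutral_right)
    show "{p. p permutes UNIV - {z}} \<subseteq> {p. p permutes UNIV}"
      by (auto intro: permutes_subset)
    show "\<forall>p\<in>{p. p permutes UNIV} - {p. p permutes UNIV - {z}}. ?g p = 0"
    proof
      fix p assume p: "p \<in> {p. p permutes UNIV} - {p. p permutes UNIV - {z}}"
      then have pz: "p z \<noteq> z" by (auto simp: permutes_def)
      have "surj p" using p permutes_surj by blast
      then obtain y where y: "p y = z" by (metis surj_def)
      then obtain i where "y = f i" using pz f(2) by (metis DiffI UNIV_I imageE singletonD)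
      then have "A $ f i $ p (f i) = 0" using y zero by simp
      then have "(\<Prod>i\<in>UNIV. A $ f i $ p (f i)) = 0" by (intro prod_zero) auto
      then show "?g p = 0" by (simp add: split)
    qed
  qed simp
  also have "\<dots> = (\<Sum>q | q permutes UNIV. ?g (?m q))"
    by (rule sum.reindex_bij_betw[OF bijm, symmetric])
  also have "\<dots> = (\<Sum>q | q permutes UNIV. A $ z $ z * (of_int (sign q) * (\<Prod>i\<in>UNIV. A $ f i $ f (q i))))"
  proof (rule sum.cong)
    fix q assume "q \<in> {q. q permutes (UNIV :: 'k set)}"
    then have "sign (?m q) = sign q" using f(1) by (simp add: sign_map_permutation)
    moreover have "?m q z = z" by (simp add: m_eq)
    moreover have "?m q (f i) = f (q i)" for i using f(1) by (simp add: map_permutation_apply)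
    ultimately show "?g (?m q) = A $ z $ z * (of_int (sign q) * (\<Prod>i\<in>UNIV. A $ f i $ f (q i)))"
      unfolding split by (simp add: mult_ac)
  qed simp
  also have "\<dots> = A $ z $ z * det (\<chi> i j. A $ f i $ f j)"
    by (simp add: det_def sum_distrib_left)
  finally show ?thesis .
qed

text \<open>A copy of a finite type carrying some well-order: the change of variables formula of the
  library is only available for well-ordered index types.\<close>

typedef 'a ordered_copy = "UNIV :: 'a set" ..

lemma bij_Rep_ordered_copy: "bij Rep_ordered_copy"
  by (rule bij_betwI[of _ _ _ Abs_ordered_copy])
    (auto simp: Rep_ordered_copy_inverse Abs_ordered_copy_inverse)

instance ordered_copy :: (finite) finite
proof
  have "x \<in> range Abs_ordered_copy" for x :: "'a ordered_copy"
    by (rule range_eqI[of _ _ "Rep_ordered_copy x"]) (simp add: Rep_ordered_copy_inverse)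
  then have "(UNIV :: 'a ordered_copy set) = range Abs_ordered_copy" by blast
  then show "finite (UNIV :: 'a ordered_copy set)" by (metis finite finite_imageI)
qed

lemma card_ordered_copy [simp]: "CARD('a ordered_copy) = CARD('a :: finite)"
  by (rule bij_betw_same_card[OF bij_Rep_ordered_copy])

definition position :: "'a :: finite \<Rightarrow> nat" where
  "position = (SOME f. inj f)"

lemma inj_position: "inj position"
  unfolding position_def
proof (rule someI_ex[of inj])
  show "\<exists>f :: 'a \<Rightarrow> nat. inj f" using finite_imp_inj_to_nat_seg[OF finite] by metis
qed

instantiation ordered_copy :: (finite) wellorder
begin

definition "x \<le> y \<longleftrightarrow> position (Rep_ordered_copy x) \<le> position (Rep_ordered_copy y)"
definition "x < y \<longleftrightarrow> position (Rep_ordered_copy x) < position (Rep_ordered_copy y)"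

instance
proof
  fix x y :: "'a ordered_copy"
  assume "x \<le> y" "y \<le> x"
  then show "x = y"
    by (simp add: less_eq_ordered_copy_def inj_eq[OF inj_position] Rep_ordered_copy_inject)
next
  fix P :: "'a ordered_copy \<Rightarrow> bool" and x :: "'a ordered_copy"
  assume step: "\<And>x. (\<And>y. y < x \<Longrightarrow> P y) \<Longrightarrow> P x"
  show "P x"
  proof (induction "position (Rep_ordered_copy x)" arbitrary: x rule: less_induct)
    case less
    show ?case by (rule step, rule less) (simp add: less_ordered_copy_def)
  qed
qed (auto simp: less_eq_ordered_copy_def less_ordered_copy_def)

end

definition reindex :: "real ^ 'n \<Rightarrow> real ^ 'n ordered_copy" where
  "reindex x = (\<chi> j. x $ Rep_ordered_copy j)"

lemma reindex_nth [simp]: "reindex x $ j = x $ Rep_ordered_copy j"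
  by (simp add: reindex_def)

lemma linear_reindex: "linear reindex"
  by (rule linearI) (simp_all add: vec_eq_iff)

lemma continuous_on_reindex: "continuous_on S reindex"
  by (simp add: linear_continuous_on linear_conv_bounded_linear[symmetric] linear_reindex)

lemma measurable_reindex [measurable]: "reindex \<in> borel_measurable borel"
  by (intro borel_measurable_continuous_onI continuous_on_reindex)

lemma inj_reindex: "inj reindex"
  by (rule injI) (metis Abs_ordered_copy_inverse UNIV_I reindex_nth vec_eq_iff)

lemma Basis_cart: "(Basis :: (real ^ 'n) set) = range (\<lambda>i. axis i 1)"
  by (auto simp: Basis_vec_def)

lemma inj_axis_1: "inj (\<lambda>i :: 'n :: finite. axis i (1 :: real))"
  by (simp add: inj_def axis_eq_axis)

lemma prod_Basis_cart: "(\<Prod>b\<in>Basis. x \<bullet> b) = (\<Prod>i\<in>UNIV. x $ i)" for x :: "real ^ 'n"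
  unfolding Basis_cart prod.reindex[OF inj_axis_1] by (simp add: inner_axis)

lemma sum_Basis_cart: "(\<Sum>b\<in>Basis. x \<bullet> b) = (\<Sum>i\<in>UNIV. x $ i)" for x :: "real ^ 'n"
  unfolding Basis_cart sum.reindex[OF inj_axis_1] by (simp add: inner_axis)

text \<open>Coordinates are merely renamed: boxes pull back to boxes with the same side lengths, and
  Lebesgue measure is determined by its values on boxes.\<close>

lemma lborel_distr_reindex: "distr lborel borel reindex = (lborel :: (real ^ ('n :: finite) ordered_copy) measure)"
proof (rule lborel_eqI[symmetric])
  fix l u :: "real ^ 'n ordered_copy"
  assume le: "\<And>b. b \<in> Basis \<Longrightarrow> l \<bullet> b \<le> u \<bullet> b"
  define s :: "real ^ 'n ordered_copy \<Rightarrow> real ^ 'n" where "s y = (\<chi> i. y $ Abs_ordered_copy i)" for y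
  have le': "l $ j \<le> u $ j" for j using le[of "axis j 1"] by (simp add: inner_axis)
  have all: "(\<forall>j. P (Rep_ordered_copy j) j) \<longleftrightarrow> (\<forall>i. P i (Abs_ordered_copy i))" for P :: "'n \<Rightarrow> _ \<Rightarrow> bool"
    by (metis Abs_ordered_copy_inverse Rep_ordered_copy_inverse UNIV_I)
  have "reindex -` box l u = box (s l) (s u)"
  proof (rule set_eqI)
    fix x :: "real ^ 'n"
    show "x \<in> reindex -` box l u \<longleftrightarrow> x \<in> box (s l) (s u)"
      using all[of "\<lambda>i j. l $ j < x $ i \<and> x $ i < u $ j"] by (simp add: mem_box_cart s_def)
  qed
  then have "emeasure (distr lborel borel reindex) (box l u) = emeasure lborel (box (s l) (s u))"
    by (simp add: emeasure_distr)
  also have "\<dots> = (\<Prod>b\<in>Basis. (s u - s l) \<bullet> b)"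
    by (rule emeasure_lborel_box) (auto simp: Basis_vec_def inner_axis s_def le')
  also have "(\<Prod>b\<in>Basis. (s u - s l) \<bullet> b) = (\<Prod>j\<in>UNIV. (u - l) $ j)"
    unfolding prod_Basis_cart
    using prod.reindex_bij_betw[OF bij_Rep_ordered_copy, of "\<lambda>i. (s u - s l) $ i"]
    by (simp add: s_def Rep_ordered_copy_inverse)
  finally show "emeasure (distr lborel borel reindex) (box l u) = (\<Prod>b\<in>Basis. (u - l) \<bullet> b)"
    unfolding prod_Basis_cart .
qed simp

lemma content_reindex:
  assumes "compact S"
  shows "measure lborel (reindex ` S) = measure lborel (S :: (real ^ 'n) set)"
proof -
  have "compact (reindex ` S)"
    by (intro compact_continuous_image assms continuous_on_reindex)
  then have "reindex ` S \<in> sets borel" by (simp add: compact_imp_closed)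
  then have "measure (distr lborel borel reindex) (reindex ` S) = measure lborel (reindex -` (reindex ` S))"
    by (simp add: measure_distr)
  then show ?thesis
    by (simp add: lborel_distr_reindex inj_vimage_image_eq[OF inj_reindex])
qed

text \<open>Multiplying by \<open>L\<close> subtracts the row \<open>None\<close> from all other
  rows. This leaves a single 1 in the height column, and the remaining minor consists of the edge
  vectors at \<open>g None\<close>.\<close>

lemma det_simplex_matrix:
  fixes g :: "('n :: finite) option \<Rightarrow> real ^ 'n" and f :: "'k :: finite \<Rightarrow> 'n"
  assumes f: "bij f"
  shows "det (\<chi> j. hom1 (g j)) = det (\<chi> i j. g (Some (f i)) $ f j - g None $ f j)"
proof -
  define L :: "real ^ 'n option ^ 'n option" where
    "L = (\<chi> i k. of_bool (i = k) - of_bool (i \<noteq> None \<and> k = None))"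
  define W :: "real ^ 'n option ^ 'n option" where "W = (\<chi> j. hom1 (g j))"
  have rs: "range (Some :: 'n \<Rightarrow> _) = UNIV - {None}" 
    by (auto simp: notin_range_Some)
  \<comment> \<open>\<open>det_block\<close> needs the zeros in a column, whereas \<open>L\<close>
    has them in the row \<open>None\<close>.\<close>
  have "det L = det (transpose L)" by simp
  also have "\<dots> = transpose L $ None $ None * det (\<chi> i j. transpose L $ Some i $ Some j)"
    by (rule det_block) (use rs in \<open>auto simp: L_def transpose_def\<close>)
  also have "(\<chi> i j. transpose L $ Some i $ Some j) = mat 1"
    by (auto simp: vec_eq_iff L_def transpose_def mat_def)
  finally have L: "det L = 1" by (simp add: L_def transpose_def)
  have LW: "(L ** W) $ Some i $ k = W $ Some i $ k - W $ None $ k" "(L ** W) $ None $ k = W $ None $ k" for i k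
    using sum_of_bool_eq[of "\<lambda>j. W $ Some j $ k" i]
    by (simp_all add: L_def matrix_matrix_mult_def sum_UNIV_option mult.commute eq_commute)
  have "range (Some \<circ> f) = UNIV - {None}"
    using f rs by (metis bij_is_surj image_comp)
  moreover have "inj (Some \<circ> f)" using f by (simp add: bij_is_inj inj_compose)
  moreover have "(L ** W) $ (Some \<circ> f) i $ None = 0" for i
    by (simp add: LW) (simp add: W_def)
  ultimately have "det (L ** W) = (L ** W) $ None $ None *
      det (\<chi> i j. (L ** W) $ (Some \<circ> f) i $ (Some \<circ> f) j)"
    by (intro det_block)
  also have "\<dots> = det (\<chi> i j. g (Some (f i)) $ f j - g None $ f j)"
    by (simp add: LW) (simp add: W_def)
  finally show ?thesis using L by (simp add: det_mul W_def)
qed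

text \<open>The volume formula by edge vectors is applied to the reindexed simplex;
  \<open>det_simplex_matrix\<close> then makes it symmetric in the vertices, ready for scaling each
  row by a denominator.\<close>

lemma content_simplex_hom1:
  fixes g :: "('n :: finite) option \<Rightarrow> real ^ 'n"
  assumes "inj g"
  shows "measure lborel (convex hull (range g)) = \<bar>det (\<chi> j. hom1 (g j))\<bar> / fact CARD('n)"
proof -
  let ?X = "range (reindex \<circ> g)"
  have inj: "inj (reindex \<circ> g)" by (rule inj_compose[OF inj_reindex assms])
  have cardX: "card ?X = Suc CARD('n ordered_copy)"
    unfolding card_image[OF inj] by (simp add: card_UNIV_option)
  let ?f = "\<lambda>j. reindex (g (Some (Rep_ordered_copy j)))"
  have "bij_betw ?f UNIV (?X - {reindex (g None)})"
  proof (rule bij_betw_imageI)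
    show "inj ?f"
    proof (rule injI)
      fix j k assume "?f j = ?f k"
      then show "j = k" using injD[OF inj, of "Some (Rep_ordered_copy j)" "Some (Rep_ordered_copy k)"]
        by (simp add: Rep_ordered_copy_inject)
    qed
    have "range ?f = (reindex \<circ> g) ` Some ` range Rep_ordered_copy" by auto
    also have "\<dots> = (reindex \<circ> g) ` (UNIV - {None})"
      unfolding bij_is_surj[OF bij_Rep_ordered_copy] by (metis notin_range_Some UNIV_option_conv Diff_insert_absorb)
    also have "\<dots> = ?X - {reindex (g None)}"
      unfolding image_set_diff[OF inj] by simp
    finally show "range ?f = ?X - {reindex (g None)}" .
  qed
  note content = content_simplex[OF _ cardX _ this]
  have "convex hull ?X = reindex ` (convex hull (range g))"
    unfolding image_comp[symmetric] by (rule convex_hull_linear_image[OF linear_reindex, symmetric])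
  moreover have "compact (convex hull (range g))"
    by (intro finite_imp_compact_convex_hull) simp
  ultimately have "measure lborel (convex hull (range g)) = measure lborel (convex hull ?X)"
    by (simp add: content_reindex)
  also have "\<dots> = \<bar>det (\<chi> i j. ?f j $ i - reindex (g None) $ i)\<bar> / fact CARD('n ordered_copy)"
    by (rule content) auto
  also have "(\<chi> i j. ?f j $ i - reindex (g None) $ i) =
      transpose (\<chi> i j. g (Some (Rep_ordered_copy i)) $ Rep_ordered_copy j - g None $ Rep_ordered_copy j)"
    by (simp add: vec_eq_iff transpose_def)
  also have "det \<dots> = det (\<chi> j. hom1 (g j))"
    by (simp add: det_simplex_matrix[OF bij_Rep_ordered_copy])
  finally show ?thesis by simp
qed

section \<open>Lattice determinants and the comparison with Lebesgue measure\<close>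

lemma det_of_int: "det (\<chi> i j. real_of_int (A i j)) = real_of_int (det (\<chi> i j. A i j))"
  by (simp add: det_def)

text \<open>The vectors of \<open>h\<close> already exhaust \<open>B\<close>: by the integral dual
  basis, a further member \<open>e\<close> would have the multiple \<open>int D *s e\<close> in
  their integral span, against independence. So the unit vectors are integral combinations of them,
  and the integer determinant is a unit.\<close>

lemma det_part_of_lattice_basis:
  fixes h :: "'m \<Rightarrow> int ^ 'm"
  assumes B: "lattice_basis B" "range h \<subseteq> B" and inj: "inj h" and nz: "det (\<chi> i. real_vec (h i)) \<noteq> 0"
  shows "\<bar>det (\<chi> i. real_vec (h i))\<bar> = 1"
proof -
  have ind: "int_vec.independent B" and sp: "int_vec.span B = UNIV"
    using B by (auto simp: lattice_basis_def)
  obtain D u where D: "D > (0::nat)"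
    and u: "\<And>y. real D *\<^sub>R y = (\<Sum>i\<in>UNIV. (real_vec (u i) \<bullet> y) *\<^sub>R real_vec (h i))"
    by (rule integral_dual_basis[OF nz]) (simp, rule that)
  have B_eq: "B = range h"
  proof (rule ccontr)
    assume "B \<noteq> range h"
    then obtain e where e: "e \<in> B" "e \<notin> range h" using B(2) by auto
    define c where "c v = (if v = e then - int D else pairing (u (inv h v)) e)" for v
    have "real_of_int ((int D *s e) $ k) = real_of_int ((\<Sum>i\<in>UNIV. pairing (u i) e *s h i) $ k)" for k
      using arg_cong[OF u[of "real_vec e"], of "\<lambda>y. y $ k"] by (simp add: real_pairing)
    then have De: "int D *s e = (\<Sum>i\<in>UNIV. pairing (u i) e *s h i)"
      unfolding of_int_eq_iff by (simp add: vec_eq_iff)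
    have "(\<Sum>v\<in>range h. c v *s v) = (\<Sum>i\<in>UNIV. c (h i) *s h i)"
      using inj by (simp add: sum.reindex)
    also have "\<dots> = int D *s e"
      unfolding De using e(2) inj by (intro sum.cong) (auto simp: c_def)
    finally have "(\<Sum>v\<in>insert e (range h). c v *s v) = 0"
      using e(2) by (simp add: c_def vec_eq_iff)
    then have "c e = 0"
      using int_vec.independentD[OF ind, of "insert e (range h)" c e] e B(2) by auto
    then show False using D by (simp add: c_def)
  qed
  have "\<exists>w. axis k 1 = (\<Sum>i\<in>UNIV. w i *s h i)" for k
  proof -
    have "axis k 1 \<in> int_vec.span (range h)" using sp B_eq by simp
    then obtain w where "axis k 1 = (\<Sum>v\<in>range h. w v *s v)"
      by (auto simp: int_vec.span_finite)
    then have "axis k 1 = (\<Sum>i\<in>UNIV. w (h i) *s h i)" using inj by (simp only: sum.reindex o_def)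
    then show ?thesis by (rule exI[of _ "\<lambda>i. w (h i)"])
  qed
  then obtain w where w: "\<And>k. axis k 1 = (\<Sum>i\<in>UNIV. w k i *s h i)" by metis
  have "(\<chi> k i. w k i) ** (\<chi> i j. h i $ j) = mat 1"
    unfolding vec_eq_iff
  proof (intro allI)
    fix k j
    have "(mat 1 :: int ^ 'm ^ 'm) $ k $ j = axis k 1 $ j" by (auto simp: mat_def axis_def)
    then show "((\<chi> k i. w k i) ** (\<chi> i j. h i $ j)) $ k $ j = (mat 1 :: int ^ 'm ^ 'm) $ k $ j"
      unfolding w by (simp add: matrix_matrix_mult_def)
  qed
  then have "det (\<chi> k i. w k i) * det (\<chi> i j. h i $ j) = 1"
    by (metis det_I det_mul)
  then have "\<bar>det (\<chi> i j. h i $ j)\<bar> = 1"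
    using abs_zmult_eq_1[of "det (\<chi> i j. h i $ j)" "det (\<chi> k i. w k i)"] by (simp add: mult.commute)
  moreover have "(\<chi> i. real_vec (h i)) = (\<chi> i j. real_of_int (h i $ j))"
    by (simp add: vec_eq_iff)
  ultimately show ?thesis by (simp add: det_of_int)
qed

lemma content_regular_simplex:
  fixes T :: "(real ^ 'n) set"
  assumes reg: "regular_simplex T" and dim: "int CARD('n) simplex T"
  shows "measure lborel T = 1 / (fact CARD('n) * real (simplex_den T))"
proof -
  obtain C where C: "finite C" "\<not> affine_dependent C" "int (card C) = int CARD('n) + 1" "T = convex hull C"
    using dim by (auto simp: simplex)
  have vert: "vertices T = C" using C vertices_convex_hull by simp
  obtain B where B: "lattice_basis B" "homogeneous ` C \<subseteq> B" and rat: "\<And>v. v \<in> C \<Longrightarrow> rational_point v"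
    using reg by (auto simp: regular_simplex_def rational_simplex_def vert)
  have "card C = CARD('n option)" using C(3) by (simp add: card_UNIV_option)
  then obtain g where g: "bij_betw g (UNIV :: 'n option set) C"
    using C(1) by (metis finite finite_same_card_bij)
  then have inj: "inj g" and range: "range g = C" by (auto simp: bij_betw_def)
  have ratg: "rational_point (g j)" for j using rat range by auto
  have rv: "real_vec (homogeneous (g j)) = real (den (g j)) *s hom1 (g j)" for j
    using real_vec_homogeneous[OF ratg] by (simp add: scalar_mult_eq_scaleR)
  have det_eq: "det (\<chi> j. real_vec (homogeneous (g j))) = (\<Prod>j\<in>UNIV. real (den (g j))) * det (\<chi> j. hom1 (g j))"
    unfolding rv by (rule det_rows_mul)
  have den: "(\<Prod>j\<in>UNIV. real (den (g j))) = real (simplex_den T)"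
    unfolding simplex_den_def vert using prod.reindex_bij_betw[OF g, of den] by (simp flip: of_nat_prod)
  have pos: "0 < real (simplex_den T)"
    unfolding den[symmetric] by (rule prod_pos) (simp add: den_pos ratg)
  have "det (\<chi> j. hom1 (g j)) \<noteq> 0"
  proof (rule det_nonzero_if_independent)
    show "inj (\<lambda>j. hom1 (g j))" using inj by (simp add: inj_def)
    have "range (\<lambda>j. hom1 (g j)) = hom1 ` C" using range by auto
    then show "independent (range (\<lambda>j. hom1 (g j)))" using C affine_dependent_hom1 by auto
  qed
  then have nz: "det (\<chi> j. real_vec (homogeneous (g j))) \<noteq> 0" using det_eq den pos by simp
  have "inj (\<lambda>j. homogeneous (g j))"
  proof (rule injI)
    fix j k assume eq: "homogeneous (g j) = homogeneous (g k)"
    then have "real_vec (homogeneous (g j)) = real_vec (homogeneous (g k))" by simp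
    then have *: "real (den (g j)) *\<^sub>R hom1 (g j) = real (den (g k)) *\<^sub>R hom1 (g k)"
      by (simp add: real_vec_homogeneous ratg)
    from arg_cong[OF this, of "\<lambda>y. y $ None"] have "den (g j) = den (g k)" by simp
    then have "g j = g k" using * den_pos[OF ratg, of k] by simp
    then show "j = k" using inj by (simp add: inj_eq)
  qed
  moreover have "range (\<lambda>j. homogeneous (g j)) \<subseteq> B" using B(2) range by auto
  ultimately have "\<bar>det (\<chi> j. real_vec (homogeneous (g j)))\<bar> = 1"
    using det_part_of_lattice_basis[OF B(1) _ _ nz] by blast
  then have "real (simplex_den T) * \<bar>det (\<chi> j. hom1 (g j))\<bar> = 1"
    unfolding det_eq den by (simp add: abs_mult)
  then have "\<bar>det (\<chi> j. hom1 (g j))\<bar> = 1 / real (simplex_den T)"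
    using pos by (simp add: field_simps)
  then show ?thesis
    unfolding C(4) range[symmetric] content_simplex_hom1[OF inj] by (simp add: mult.commute)
qed

lemma negligible_low_dim_simplex:
  fixes T :: "(real ^ 'n) set"
  assumes "convex T" "aff_dim T \<noteq> int CARD('n)"
  shows "negligible T"
  using assms low_dim_interior[of T] negligible_convex_interior[of T] by simp

text \<open>Lower-dimensional simplexes and the intersections of distinct \<open>n\<close>-simplexes
  are negligible, so Lebesgue measure is the sum of the volumes of the
  \<open>n\<close>-simplexes.\<close>

lemma triangulation_measure_eq:
  fixes P :: "(real ^ 'n) set"
  assumes "regular_triangulation \<Delta> P"
  shows "triangulation_measure \<Delta> = measure lebesgue P"
proof -
  have sc: "simplicial_complex \<Delta>" and reg: "\<And>T. T \<in> \<Delta> \<Longrightarrow> regular_simplex T" and P: "\<Union>\<Delta> = P"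
    using assms by (auto simp: regular_triangulation_def)
  have fin: "finite \<Delta>" and simplex: "\<And>T. T \<in> \<Delta> \<Longrightarrow> \<exists>m. m simplex T"
    and face: "\<And>S T. S \<in> \<Delta> \<Longrightarrow> T \<in> \<Delta> \<Longrightarrow> (S \<inter> T) face_of S"
    using sc by (auto simp: simplicial_complex_def)
  have conv: "convex T" and comp: "compact T" if "T \<in> \<Delta>" for T
    using simplex[OF that] convex_simplex compact_simplex by blast+
  define \<Delta>n where "\<Delta>n = {T \<in> \<Delta>. int CARD('n) simplex T}"
  have neg: "negligible T" if T: "T \<in> \<Delta> - \<Delta>n" for T
  proof -
    obtain m where m: "m simplex T" using simplex[of T] T by blast
    then have "aff_dim T \<noteq> int CARD('n)" using T aff_dim_simplex[OF m] by (auto simp: \<Delta>n_def)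
    then show ?thesis using negligible_low_dim_simplex[of T] conv[of T] T by blast
  qed
  have "P = \<Union>\<Delta>n \<union> \<Union>(\<Delta> - \<Delta>n)" using P by (auto simp: \<Delta>n_def)
  moreover have "\<Union>(\<Delta> - \<Delta>n) \<in> null_sets lebesgue"
    unfolding negligible_iff_null_sets[symmetric] using fin neg by (intro negligible_Union) auto
  moreover have "compact (\<Union>\<Delta>n)" using fin comp by (intro compact_Union) (auto simp: \<Delta>n_def)
  then have "\<Union>\<Delta>n \<in> sets lebesgue" using lmeasurable_compact by blast
  ultimately have "measure lebesgue P = measure lebesgue (\<Union>\<Delta>n)"
    by (simp add: measure_Un_null_set)
  also have "\<dots> = (\<Sum>T\<in>\<Delta>n. measure lebesgue T)"
  proof (rule measure_negligible_finite_Union)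
    show "finite \<Delta>n" using fin by (simp add: \<Delta>n_def)
    show "T \<in> lmeasurable" if "T \<in> \<Delta>n" for T
      using comp that lmeasurable_compact by (auto simp: \<Delta>n_def)
    show "pairwise (\<lambda>S T. negligible (S \<inter> T)) \<Delta>n"
    proof (rule pairwiseI)
      fix S T assume S: "S \<in> \<Delta>n" and T: "T \<in> \<Delta>n" and ne: "S \<noteq> T"
      have D: "S \<in> \<Delta>" "T \<in> \<Delta>" "aff_dim S = int CARD('n)" "aff_dim T = int CARD('n)"
        using S T aff_dim_simplex by (auto simp: \<Delta>n_def)
      have "aff_dim (S \<inter> T) \<noteq> int CARD('n)"
      \<comment> \<open>A proper face has smaller dimension. If the intersection were all of
        \<open>S\<close>, then \<open>S\<close> would be a proper face of \<open>T\<close>, although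
        both have full dimension.\<close>
      proof (cases "S \<inter> T = S")
        case True
        then have "S face_of T" using face[OF D(2,1)] by (simp add: Int_commute)
        then show ?thesis using face_of_aff_dim_lt[OF conv[OF D(2)]] ne D by fastforce
      next
        case False
        then show ?thesis using face_of_aff_dim_lt[OF conv[OF D(1)] face[OF D(1,2)]] D by simp
      qed
      then show "negligible (S \<inter> T)"
        using negligible_low_dim_simplex convex_Int conv D by blast
    qed
  qed
  also have "\<dots> = (\<Sum>T\<in>\<Delta>n. 1 / (fact CARD('n) * real (simplex_den T)))"
  proof (rule sum.cong)
    fix T assume T: "T \<in> \<Delta>n"
    then have "T \<in> sets borel" using comp by (auto simp: \<Delta>n_def intro: borel_compact)
    then have "measure lebesgue T = measure lborel T" by simp
    also have "\<dots> = 1 / (fact CARD('n) * real (simplex_den T))"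
      using T reg by (intro content_regular_simplex) (auto simp: \<Delta>n_def)
    finally show "measure lebesgue T = 1 / (fact CARD('n) * real (simplex_den T))" .
  qed simp
  finally show ?thesis by (simp add: triangulation_measure_def \<Delta>n_def)
qed

lemma rational_measure_eq:
  assumes "rational_polyhedron P"
  shows "rational_measure P = measure lebesgue P"
  unfolding rational_measure_def
  by (rule triangulation_measure_eq, rule someI_ex, rule regular_triangulation_exists, fact)

section \<open>Approximation by rational polyhedra\<close>

text \<open>The simplex is a copy of the standard one, scaled by a rational \<open>r\<close> and
  moved to a rational corner \<open>p\<close> slightly below \<open>x\<close> in every
  coordinate.\<close>

lemma rational_simplex_neighbourhood:
  fixes x :: "real ^ 'n"
  assumes "open U" "x \<in> U"
  shows "\<exists>T. rational_simplex T \<and> x \<in> interior T \<and> T \<subseteq> U"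
proof -
  obtain e where e: "e > 0" "ball x e \<subseteq> U" using assms openE by blast
  \<comment> \<open>Both \<open>x\<close> and all points of the simplex lie within \<open>r\<close>
    of \<open>p\<close>, hence at distance at most \<open>2 * r < e\<close> from each other.\<close>
  obtain r where r: "r \<in> \<rat>" "0 < r" "r < e / 2"
    using Rats_dense_in_real[of 0 "e / 2"] e(1) by auto
  \<comment> \<open>With this margin each rescaled coordinate of \<open>x\<close> lies strictly
    between 0 and \<open>1 / (CARD('n) + 1)\<close>. Their sum is then below 1, which puts the
    rescaled point in the interior of the standard simplex.\<close>
  have "\<exists>q\<in>\<rat>. x $ i - r / (CARD('n) + 1) < q \<and> q < x $ i" for i
    using r(2) by (intro Rats_dense_in_real) simp
  then obtain p' where p': "\<And>i. p' i \<in> \<rat> \<and> x $ i - r / (CARD('n) + 1) < p' i \<and> p' i < x $ i"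
    by metis
  define p :: "real ^ 'n" where "p = (\<chi> i. p' i)"
  let ?std = "convex hull (insert 0 Basis) :: (real ^ 'n) set"
  define f where "f z = p + r *\<^sub>R z" for z :: "real ^ 'n"
  define z0 where "z0 = (1 / r) *\<^sub>R (x - p)"
  have x_eq: "f z0 = x" using r(2) by (simp add: f_def z0_def)
  have z0: "0 < z0 $ i" "z0 $ i < 1 / (CARD('n) + 1)" for i
    using p'[of i] r(2) by (simp_all add: z0_def p_def field_simps)
  have "(\<Sum>i\<in>UNIV. z0 $ i) < (\<Sum>i\<in>(UNIV :: 'n set). 1 / (CARD('n) + 1))"
    by (rule sum_strict_mono) (simp_all only: finite UNIV_not_empty not_False_eq_True z0)
  also have "\<dots> \<le> 1" by simp
  finally have "z0 \<in> interior ?std"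
    unfolding interior_std_simplex using z0(1)
    by (simp add: sum_Basis_cart) (auto simp: Basis_cart inner_axis)
  then have "x \<in> f ` interior ?std" using x_eq by blast
  moreover have "open (f ` interior ?std)"
    unfolding f_def[abs_def] using r(2) by (intro open_affinity) auto
  moreover have "f ` interior ?std \<subseteq> f ` ?std" using interior_subset by blast
  ultimately have "x \<in> interior (f ` ?std)" using interior_maximal by blast
  moreover have "rational_simplex (f ` ?std)"
    unfolding rational_simplex_iff
  proof (intro exI conjI ballI)
    show "f ` ?std = convex hull (insert p (f ` Basis))"
      unfolding f_def[abs_def] convex_hull_affinity[symmetric] by simp
    show "finite (insert p (f ` Basis))" by simp
    have "(\<lambda>y. y - p) ` f ` Basis = (*\<^sub>R) r ` Basis" by (simp add: f_def image_image)
    moreover have "independent ((*\<^sub>R) r ` (Basis :: (real ^ 'n) set))"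
      by (rule pairwise_orthogonal_independent)
        (use r(2) in \<open>auto simp: pairwise_def orthogonal_def inner_Basis nonzero_Basis\<close>)
    moreover have "p \<notin> f ` Basis" using r(2) by (auto simp: f_def nonzero_Basis)
    ultimately show "\<not> affine_dependent (insert p (f ` Basis))"
      by (simp add: affine_dependent_iff_dependent)
    show "rational_point v" if "v \<in> insert p (f ` Basis)" for v
      using that p' r(1) by (auto simp: rational_point_def f_def p_def Basis_vec_def axis_def)
  qed
  moreover have "f ` ?std \<subseteq> U"
  proof -
    have "?std \<subseteq> cball 0 1" by (rule hull_minimal) auto
    have fp: "dist p (f z) \<le> r" if "z \<in> ?std" for z
    proof -
      have "norm z \<le> 1" using that \<open>?std \<subseteq> cball 0 1\<close> by auto
      then show ?thesis using r(2) by (simp add: f_def dist_norm mult_left_le)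
    qed
    have "z0 \<in> ?std" using \<open>z0 \<in> interior ?std\<close> interior_subset by blast
    then have "dist p x \<le> r" using fp x_eq by blast
    have "f z \<in> ball x e" if "z \<in> ?std" for z
      using dist_triangle3[of x "f z" p] fp[OF that] \<open>dist p x \<le> r\<close> r(3) by simp
    then show ?thesis using e(2) by blast
  qed
  ultimately show ?thesis by blast
qed

lemma rational_polyhedron_between:
  fixes K :: "(real ^ 'n) set"
  assumes K: "compact K" and U: "open U" "K \<subseteq> U"
  obtains P where "rational_polyhedron P" "K \<subseteq> P" "P \<subseteq> U"
proof -
  have "\<forall>x\<in>K. \<exists>T. rational_simplex T \<and> x \<in> interior T \<and> T \<subseteq> U"
    using rational_simplex_neighbourhood[OF U(1)] U(2) by blast
  then obtain T where T: "\<And>x. x \<in> K \<Longrightarrow> rational_simplex (T x) \<and> x \<in> interior (T x) \<and> T x \<subseteq> U"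
    by metis
  obtain C where C: "C \<subseteq> K" "finite C" "K \<subseteq> (\<Union>x\<in>C. interior (T x))"
    by (rule compactE_image[OF K, of K "\<lambda>x. interior (T x)"]) (use T in auto)
  show thesis
  proof (rule that[of "\<Union>(T ` C)"])
    show "rational_polyhedron (\<Union>(T ` C))"
      unfolding rational_polyhedron_def using C T by (intro exI[of _ "T ` C"]) auto
    show "K \<subseteq> \<Union>(T ` C)" using C(3) interior_subset by blast
    show "\<Union>(T ` C) \<subseteq> U" using C(1) T by blast
  qed
qed

section \<open>From polyhedra to compact sets and Borel sets\<close>

lemma compact_rational_polyhedron:
  assumes "rational_polyhedron P"
  shows "compact P"
proof -
  obtain F where F: "finite F" "\<And>T. T \<in> F \<Longrightarrow> rational_simplex T" "P = \<Union>F"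
    using assms by (auto simp: rational_polyhedron_def)
  then show ?thesis
    by (auto simp: rational_simplex_def intro!: compact_Union dest: compact_simplex)
qed

lemma ennreal_rational_measure:
  assumes "rational_polyhedron P"
  shows "ennreal (rational_measure P) = emeasure lborel P"
proof -
  have c: "compact P" by (rule compact_rational_polyhedron[OF assms])
  have "ennreal (rational_measure P) = emeasure lebesgue P"
    unfolding rational_measure_eq[OF assms] using emeasure_eq_measure2[OF lmeasurable_compact[OF c]] by simp
  then show ?thesis using borel_compact[OF c] by simp
qed

lemma INF_rational_measure_compact:
  fixes K :: "(real ^ 'n) set"
  assumes K: "compact K"
  shows "(INF P \<in> {P. rational_polyhedron P \<and> K \<subseteq> P}. ennreal (rational_measure P)) = emeasure lborel K"
proof (rule antisym)
  show "emeasure lborel K \<le> (INF P \<in> {P. rational_polyhedron P \<and> K \<subseteq> P}. ennreal (rational_measure P))"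
  proof (rule INF_greatest)
    fix P assume "P \<in> {P. rational_polyhedron P \<and> K \<subseteq> P}"
    then show "emeasure lborel K \<le> ennreal (rational_measure P)"
      using borel_compact[OF compact_rational_polyhedron, of P]
      by (auto simp: ennreal_rational_measure intro: emeasure_mono)
  qed
  show "(INF P \<in> {P. rational_polyhedron P \<and> K \<subseteq> P}. ennreal (rational_measure P)) \<le> emeasure lborel K"
  proof (rule ennreal_le_epsilon)
    fix e :: real assume "0 < e"
    then obtain U where U: "open U" "K \<subseteq> U" "emeasure lborel (U - K) < ennreal e"
      using outer_regular_lborel[of K "e"] borel_compact[OF K] by auto
    obtain P where P: "rational_polyhedron P" "K \<subseteq> P" "P \<subseteq> U"
      by (rule rational_polyhedron_between[OF K U(1,2)])
    have "(INF P \<in> {P. rational_polyhedron P \<and> K \<subseteq> P}. ennreal (rational_measure P)) \<le> ennreal (rational_measure P)"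
      by (rule INF_lower) (use P in simp)
    also have "\<dots> \<le> emeasure lborel (K \<union> (U - K))"
      unfolding ennreal_rational_measure[OF P(1)]
      by (rule emeasure_mono) (use P U borel_compact[OF K] in auto)
    also have "\<dots> \<le> emeasure lborel K + emeasure lborel (U - K)"
      by (rule emeasure_subadditive) (use U borel_compact[OF K] in auto)
    also have "\<dots> \<le> emeasure lborel K + ennreal e" using U(3) by (intro add_left_mono) simp
    finally show "(INF P \<in> {P. rational_polyhedron P \<and> K \<subseteq> P}. ennreal (rational_measure P))
      \<le> emeasure lborel K + ennreal e" .
  qed
qed

text \<open>Closed inner approximations of \<open>E\<close> intersected with a ball are compact, and
  the balls exhaust \<open>E\<close>. This also covers sets of infinite measure.\<close>

lemma inner_regular_lborel:
  fixes E :: "'a :: euclidean_space set"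
  assumes E: "E \<in> sets borel"
  shows "(SUP K \<in> {K. compact K \<and> K \<subseteq> E}. emeasure lborel K) = emeasure lborel E" (is "?S = _")
proof (rule antisym)
  show "?S \<le> emeasure lborel E"
    by (rule SUP_least) (use E in \<open>auto intro: emeasure_mono\<close>)
  let ?B = "\<lambda>n::nat. E \<inter> cball 0 (real n)"
  have bounded_part: "emeasure lborel (?B n) \<le> ?S" for n
  proof (rule ennreal_le_epsilon)
    fix e :: real assume "0 < e"
    have meas: "?B n \<in> sets borel" using E by simp
    then have "?B n \<in> sets lebesgue" by simp
    from sets_lebesgue_inner_closed[OF this \<open>0 < e\<close>]
    obtain T where T: "closed T" "T \<subseteq> ?B n" "emeasure lebesgue (?B n - T) < ennreal e"
      by metis
    have "compact T"
      using T(1,2) bounded_subset[OF bounded_cball, of T 0 "real n"] by (simp add: compact_eq_bounded_closed)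
    have "emeasure lborel (?B n) = emeasure lborel (T \<union> (?B n - T))" using T(2) by (simp add: Un_absorb1)
    also have "\<dots> \<le> emeasure lborel T + emeasure lborel (?B n - T)"
      by (rule emeasure_subadditive) (use T(1) meas in auto)
    also have "\<dots> \<le> ?S + ennreal e"
    proof (rule add_mono)
      show "emeasure lborel T \<le> ?S" by (rule SUP_upper) (use \<open>compact T\<close> T(2) in auto)
      show "emeasure lborel (?B n - T) \<le> ennreal e" using T(1,3) meas by simp
    qed
    finally show "emeasure lborel (?B n) \<le> ?S + ennreal e" .
  qed
  have "(\<Union>n. ?B n) = E"
  proof
    show "E \<subseteq> (\<Union>n. ?B n)"
    proof
      fix x assume "x \<in> E"
      moreover obtain n where "norm x \<le> real n" using real_arch_simple by blast
      ultimately show "x \<in> (\<Union>n. ?B n)" by auto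
    qed
  qed auto
  moreover have "(SUP n. emeasure lborel (?B n)) = emeasure lborel (\<Union>n. ?B n)"
    by (rule SUP_emeasure_incseq) (use E in \<open>auto simp: incseq_def\<close>)
  ultimately show "emeasure lborel E \<le> ?S"
    using SUP_least[of UNIV "\<lambda>n. emeasure lborel (?B n)" ?S] bounded_part by simp
qed

theorem corollary6p2:
  fixes E :: "(real ^ 'n) set"
  assumes "E \<in> sets borel"
  shows "rational_measure_ext E = emeasure lborel E"
proof -
  have "rational_measure_ext E = (SUP K \<in> {K. compact K \<and> K \<subseteq> E}. emeasure lborel K)"
    unfolding rational_measure_ext_def by (rule SUP_cong) (simp_all add: INF_rational_measure_compact)
  then show ?thesis using inner_regular_lborel[OF assms] by simp
qed

end
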